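(* Let $G=(V,E)$ be a connected bipartite graph, let $p\geq 1$, let $F\subseteq E$ and let $\phi: V(F)\to [p]$. If $G$ has a convex $p$-partition $\mathcal X$ such that $(F,\phi)$ is an $\mathcal X$-skeleton, then this partition $\mathcal X$ is unique. Moreover, there is a polynomial-time algorithm which, given $G$, $F$ and $\phi$, finds such a partition or determines that it does not exist.
   Context: All graphs are finite, simple and undirected; $[p]=\{1,\dots,p\}$. For a graph $G=(V,E)$, $d_G(u,v)$ is the length of a shortest path between $u$ and $v$. A set $X\subseteq V$ is convex if every vertex on some shortest path between two vertices of $X$ belongs to $X$. A convex $p$-partition of $G$ is a partition $\mathcal X=\{X_1,\dots,X_p\}$ of $V$ into $p$ (nonempty) convex sets. For $F\subseteq E$, $V(F)$ denotes the set of endvertices of edges of $F$. Given a convex $p$-partition $\mathcal X=\{X_1,\dots,X_p\}$ of $G$, a pair $(F,\phi)$ with $F\subseteq E$ and $\phi:V(F)\to[p]$ is an $\mathcal X$-skeleton if: (1) every edge of $F$ joins two distinct parts of $\mathcal X$; (2) for all $i\neq j$, if there is at least one edge of $E$ between $X_i$ and $X_j$, then exactly one edge of $F$ lies between $X_i$ and $X_j$; (3) for every $v\in V(F)$, $\phi(v)=i$ if and only if $v\in X_i$. *)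

theory Defs
  imports "HOL-Library.FuncSet" "HOL-Library.Disjoint_Sets"
    "HOL-Computational_Algebra.Polynomial"
begin

section \<open>Finite simple graphs and convex partitions\<close>

definition simple_graph :: "'a set \<Rightarrow> 'a set set \<Rightarrow> bool" where
  "simple_graph V E \<longleftrightarrow> finite V \<and> (\<forall>e\<in>E. e \<subseteq> V \<and> card e = 2)"

definition path_between :: "'a set \<Rightarrow> 'a set set \<Rightarrow> 'a \<Rightarrow> 'a list \<Rightarrow> 'a \<Rightarrow> bool" where
  "path_between V E u xs v \<longleftrightarrow>
     xs \<noteq> [] \<and> hd xs = u \<and> last xs = v \<and> set xs \<subseteq> V \<and> distinct xs \<and>
     (\<forall>i. Suc i < length xs \<longrightarrow> {xs ! i, xs ! Suc i} \<in> E)"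

definition path_length :: "'a list \<Rightarrow> nat" where
  "path_length xs = length xs - 1"

text \<open>Meaningful only if some path joins \<open>u\<close> and \<open>v\<close>.\<close>

definition graph_dist :: "'a set \<Rightarrow> 'a set set \<Rightarrow> 'a \<Rightarrow> 'a \<Rightarrow> nat" where
  "graph_dist V E u v = (LEAST k. \<exists>xs. path_between V E u xs v \<and> path_length xs = k)"

definition shortest_path :: "'a set \<Rightarrow> 'a set set \<Rightarrow> 'a \<Rightarrow> 'a list \<Rightarrow> 'a \<Rightarrow> bool" where
  "shortest_path V E u xs v \<longleftrightarrow>
     path_between V E u xs v \<and> path_length xs = graph_dist V E u v"

definition connected_graph :: "'a set \<Rightarrow> 'a set set \<Rightarrow> bool" where
  "connected_graph V E \<longleftrightarrow> (\<forall>u\<in>V. \<forall>v\<in>V. \<exists>xs. path_between V E u xs v)"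

text \<open>\<open>joins e A B\<close>: the edge \<open>e\<close> has one end in \<open>A\<close> and the other in \<open>B\<close>.\<close>

definition joins :: "'a set \<Rightarrow> 'a set \<Rightarrow> 'a set \<Rightarrow> bool" where
  "joins e A B \<longleftrightarrow> (\<exists>a\<in>A. \<exists>b\<in>B. e = {a, b})"

definition bipartite :: "'a set \<Rightarrow> 'a set set \<Rightarrow> bool" where
  "bipartite V E \<longleftrightarrow> (\<exists>A B. A \<union> B = V \<and> A \<inter> B = {} \<and> (\<forall>e\<in>E. joins e A B))"

definition convex_set :: "'a set \<Rightarrow> 'a set set \<Rightarrow> 'a set \<Rightarrow> bool" where
  "convex_set V E X \<longleftrightarrow>
     X \<subseteq> V \<and> (\<forall>u\<in>X. \<forall>v\<in>X. \<forall>xs. shortest_path V E u xs v \<longrightarrow> set xs \<subseteq> X)"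

text \<open>The parts are indexed by \<open>{1..p}\<close>; injectivity says that there are exactly \<open>p\<close> of them,
  and \<^const>\<open>partition_on\<close> includes that they are nonempty.\<close>

definition convex_partition ::
  "'a set \<Rightarrow> 'a set set \<Rightarrow> nat \<Rightarrow> (nat \<Rightarrow> 'a set) \<Rightarrow> bool" where
  "convex_partition V E p X \<longleftrightarrow>
     partition_on V (X ` {1..p}) \<and> inj_on X {1..p} \<and> (\<forall>i\<in>{1..p}. convex_set V E (X i))"

text \<open>\<open>\<Union>F\<close> is the set of end vertices of the edges in \<open>F\<close>. The values of \<open>\<phi>\<close> outside of
  \<open>\<Union>F\<close> are irrelevant.\<close>

definition skeleton ::
  "'a set set \<Rightarrow> nat \<Rightarrow> (nat \<Rightarrow> 'a set) \<Rightarrow> 'a set set \<Rightarrow> ('a \<Rightarrow> nat) \<Rightarrow> bool" where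
  "skeleton E p X F \<phi> \<longleftrightarrow>
     F \<subseteq> E \<and> \<phi> \<in> \<Union>F \<rightarrow> {1..p} \<and>
     (\<forall>e\<in>F. \<exists>i\<in>{1..p}. \<exists>j\<in>{1..p}. i \<noteq> j \<and> joins e (X i) (X j)) \<and>
     (\<forall>i\<in>{1..p}. \<forall>j\<in>{1..p}. i \<noteq> j \<longrightarrow> (\<exists>e\<in>E. joins e (X i) (X j)) \<longrightarrow>
        (\<exists>!e. e \<in> F \<and> joins e (X i) (X j))) \<and>
     (\<forall>v\<in>\<Union>F. \<forall>i\<in>{1..p}. \<phi> v = i \<longleftrightarrow> v \<in> X i)"


section \<open>Random access programs\<close>

text \<open>The model of computation is a random access machine with structured control flow. The memory
  consists of unbounded arrays of natural numbers; \<open>s a i\<close> is cell \<open>i\<close> of array \<open>a\<close>. A program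
  mentions only finitely many arrays, so they could be interleaved in a single memory.

  Costs are uniform. There is no multiplication and every node of an expression is charged, so
  one unit of time adds at most one bit to the largest number in use (apart from the constants
  fixed in the program). Hence polynomial time in this model is polynomial time on a Turing
  machine.\<close>

type_synonym memory = "nat \<Rightarrow> nat \<Rightarrow> nat"

datatype expr =
    Lit nat
  | Cell nat expr
  | Plus expr expr
  | Monus expr expr

primrec expr_val :: "expr \<Rightarrow> memory \<Rightarrow> nat" where
  "expr_val (Lit k) s = k"
| "expr_val (Cell a e) s = s a (expr_val e s)"
| "expr_val (Plus e f) s = expr_val e s + expr_val f s"
| "expr_val (Monus e f) s = expr_val e s - expr_val f s"

primrec expr_cost :: "expr \<Rightarrow> nat" where
  "expr_cost (Lit k) = 1"
| "expr_cost (Cell a e) = 1 + expr_cost e"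
| "expr_cost (Plus e f) = 1 + expr_cost e + expr_cost f"
| "expr_cost (Monus e f) = 1 + expr_cost e + expr_cost f"

text \<open>\<open>Assign a e f\<close> writes the value of \<open>f\<close> to the cell of array \<open>a\<close> whose index is the value
  of \<open>e\<close>. Conditions hold if their value is nonzero.\<close>

datatype prog =
    Skip
  | Assign nat expr expr
  | Seq prog prog
  | Cond expr prog prog
  | While expr prog

text \<open>\<open>exec P s t s'\<close>: started in \<open>s\<close>, the program \<open>P\<close> halts in \<open>s'\<close> after exactly \<open>t\<close> units of
  time.\<close>

inductive exec :: "prog \<Rightarrow> memory \<Rightarrow> nat \<Rightarrow> memory \<Rightarrow> bool" where
  Skip: "exec Skip s 1 s"
| Assign: "exec (Assign a e f) s (1 + expr_cost e + expr_cost f)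
             (s(a := (s a)(expr_val e s := expr_val f s)))"
| Seq: "exec P s t s' \<Longrightarrow> exec Q s' u s'' \<Longrightarrow> exec (Seq P Q) s (t + u) s''"
| CondTrue: "expr_val b s \<noteq> 0 \<Longrightarrow> exec P s t s' \<Longrightarrow>
             exec (Cond b P Q) s (1 + expr_cost b + t) s'"
| CondFalse: "expr_val b s = 0 \<Longrightarrow> exec Q s t s' \<Longrightarrow>
             exec (Cond b P Q) s (1 + expr_cost b + t) s'"
| WhileFalse: "expr_val b s = 0 \<Longrightarrow> exec (While b P) s (1 + expr_cost b) s"
| WhileTrue: "expr_val b s \<noteq> 0 \<Longrightarrow> exec P s t s' \<Longrightarrow> exec (While b P) s' u s'' \<Longrightarrow>
             exec (While b P) s (1 + expr_cost b + t + u) s''"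

lemma exec_deterministic:
  "exec P s t s' \<Longrightarrow> exec P s u s'' \<Longrightarrow> t = u \<and> s' = s''"
proof (induction arbitrary: u s'' rule: exec.induct)
  case (Skip s)
  then show ?case by cases auto
next
  case (Assign a e f s)
  then show ?case by cases auto
next
  case (Seq P s t s' Q u s'')
  from Seq.prems show ?case by cases (use Seq.IH in blast)
next
  case (CondTrue b s P t s' Q)
  from CondTrue.prems show ?case by cases (use CondTrue.hyps CondTrue.IH in blast)+
next
  case (CondFalse b s Q t s' P)
  from CondFalse.prems show ?case by cases (use CondFalse.hyps CondFalse.IH in blast)+
next
  case (WhileFalse b s P)
  from WhileFalse.prems show ?case by cases (use WhileFalse.hyps in blast)+
next
  case (WhileTrue b s P t s' u s'')
  from WhileTrue.prems show ?case by cases (use WhileTrue.hyps WhileTrue.IH in blast)+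
qed


section \<open>Input and output\<close>

text \<open>Graphs given to a program have vertex set \<open>{..<n}\<close>. The sets \<open>E\<close> and \<open>F\<close> are presented by
  their adjacency matrices, stored row by row.\<close>

definition adj_matrix :: "nat \<Rightarrow> nat set set \<Rightarrow> nat \<Rightarrow> nat" where
  "adj_matrix n E k = (if k < n * n \<and> {k div n, k mod n} \<in> E then 1 else 0)"

definition input ::
  "nat \<Rightarrow> nat set set \<Rightarrow> nat \<Rightarrow> nat set set \<Rightarrow> (nat \<Rightarrow> nat) \<Rightarrow> memory" where
  "input n E p F \<phi> = (\<lambda>_ _. 0)
     (0 := (\<lambda>_. 0)(0 := n, 1 := p),
      1 := adj_matrix n E,
      2 := adj_matrix n F,
      3 := (\<lambda>v. if v \<in> \<Union>F then \<phi> v else 0))"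

text \<open>The program accepts by leaving a nonzero value in cell 0 of array 0; in that case cell \<open>v\<close>
  of array 1 holds the index of the part that contains \<open>v\<close>.\<close>

definition accepted :: "memory \<Rightarrow> bool" where
  "accepted s \<longleftrightarrow> s 0 0 \<noteq> 0"

definition output_part :: "nat \<Rightarrow> memory \<Rightarrow> nat \<Rightarrow> nat set" where
  "output_part n s i = {v \<in> {..<n}. s 1 v = i}"

end

theory Submission imports Defs begin

text \<open>Write \<open>I(v, a)\<close> for the set of vertices on shortest paths between \<open>v\<close> and \<open>a\<close>, and say that
  \<open>w\<close> is on the \<open>i\<close>-side if \<open>d w x < d w y\<close> for all edges \<open>xy\<close> in \<open>F\<close> with \<open>\<phi> x = i\<close>.
  Since the graph is bipartite, \<open>d w x\<close> and \<open>d w y\<close> differ, so by convexity every vertex of the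
  part \<open>X i\<close> is on the \<open>i\<close>-side. If \<open>a\<close> in \<open>V(F)\<close> has \<open>\<phi> a = i\<close>, then
  \<open>v \<in> X i\<close> if and only if all of \<open>I(v, a)\<close> is on the \<open>i\<close>-side: a shortest path from a vertex
  outside \<open>X i\<close> to \<open>a\<close> enters \<open>X i\<close> from some part \<open>X j\<close>, at a vertex \<open>w\<close> of \<open>X j\<close>; then \<open>w\<close> is
  on the \<open>j\<close>-side, hence on the wrong side of the edge of \<open>F\<close> between \<open>X i\<close> and \<open>X j\<close>.
  This criterion does not mention the partition, so the partition is unique. It also yields the
  algorithm: compute all distances, read off the only candidate, and check it.\<close>

section \<open>Distances and intervals\<close>

locale connected_simple_graph =
  fixes V :: "'a set" and E :: "'a set set"
  assumes simple: "simple_graph V E" and conn: "connected_graph V E"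
begin

abbreviation d :: "'a \<Rightarrow> 'a \<Rightarrow> nat" where "d \<equiv> graph_dist V E"

text \<open>Repeated vertices are allowed, so that walks can be cut and concatenated without a
  distinctness condition; a walk of minimal length is a path anyway.\<close>

definition walk :: "'a \<Rightarrow> 'a list \<Rightarrow> 'a \<Rightarrow> bool" where
  "walk u xs v \<longleftrightarrow> xs \<noteq> [] \<and> hd xs = u \<and> last xs = v \<and> set xs \<subseteq> V \<and>
     successively (\<lambda>a b. {a, b} \<in> E) xs"

lemma edgeD: "{u, v} \<in> E \<Longrightarrow> u \<in> V \<and> v \<in> V \<and> u \<noteq> v"
  using simple unfolding simple_graph_def by (cases "u = v") auto

lemma edgeE:
  assumes "e \<in> E" obtains u v where "e = {u, v}" "u \<in> V" "v \<in> V"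
proof -
  have "e \<subseteq> V" "card e = 2" using assms simple unfolding simple_graph_def by blast+
  then show thesis using that unfolding card_2_iff by blast
qed

lemma path_iff: "path_between V E u xs v \<longleftrightarrow> walk u xs v \<and> distinct xs"
  unfolding path_between_def walk_def successively_conv_nth by auto

lemma walk_append_iff:
  "walk u (as @ w # bs) v \<longleftrightarrow> walk u (as @ [w]) w \<and> walk w (w # bs) v"
  by (cases "as = []") (auto simp: walk_def successively_append_iff hd_append)

text \<open>The closed piece between two occurrences of a vertex is cut out.\<close>

lemma walk_shorten:
  assumes "walk u xs v" "\<not> distinct xs"
  obtains ys where "walk u ys v" "length ys < length xs"
proof -
  obtain as y bs cs where xs: "xs = as @ [y] @ bs @ [y] @ cs"
    using not_distinct_decomp[OF assms(2)] by blast
  then have "walk u (as @ [y]) y" "walk y ((y # bs) @ y # cs) v"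
    using assms(1) walk_append_iff[of u as y "bs @ y # cs" v] by auto
  then have "walk u (as @ y # cs) v"
    using walk_append_iff by blast
  then show thesis using that xs by simp
qed

text \<open>Cutting out repetitions turns the walk into a path, to which the minimality in
  \<open>graph_dist\<close> applies. The \<open>+ 1\<close> on the left avoids truncated
  subtraction.\<close>

lemma dist_le_walk: "walk u xs v \<Longrightarrow> d u v + 1 \<le> length xs"
proof (induction "length xs" arbitrary: xs rule: less_induct)
  case less
  show ?case
  proof (cases "distinct xs")
    case True
    then have "d u v \<le> length xs - 1"
      using less.prems path_iff unfolding graph_dist_def path_length_def
      by (intro Least_le) blast
    then show ?thesis using less.prems by (cases xs) (auto simp: walk_def)
  next
    case False
    then obtain ys where "walk u ys v" "length ys < length xs"
      using walk_shorten less.prems by blast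
    then show ?thesis using less.hyps by fastforce
  qed
qed

lemma shortest_walk:
  assumes "u \<in> V" "v \<in> V" obtains xs where "walk u xs v" "length xs = d u v + 1"
proof -
  have "\<exists>k xs. path_between V E u xs v \<and> path_length xs = k"
    using conn assms unfolding connected_graph_def by blast
  then have "\<exists>xs. path_between V E u xs v \<and> path_length xs = d u v"
    unfolding graph_dist_def by (rule LeastI_ex)
  then obtain xs where "path_between V E u xs v" "path_length xs = d u v" by blast
  then show thesis using that[of xs] path_iff unfolding path_length_def
    by (cases xs) (auto simp: walk_def)
qed

text \<open>Distinctness comes for free: cutting out a repetition would give a walk shorter than the
  distance.\<close>

lemma shortest_path_iff: "shortest_path V E u xs v \<longleftrightarrow> walk u xs v \<and> length xs = d u v + 1"
proof
  assume "shortest_path V E u xs v"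
  then show "walk u xs v \<and> length xs = d u v + 1"
    unfolding shortest_path_def path_iff path_length_def by (cases xs) (auto simp: walk_def)
next
  assume *: "walk u xs v \<and> length xs = d u v + 1"
  then have "distinct xs" using walk_shorten dist_le_walk by (metis not_less)
  with * show "shortest_path V E u xs v"
    unfolding shortest_path_def path_iff path_length_def by simp
qed

lemma walk_rev: "walk u xs v \<Longrightarrow> walk v (rev xs) u"
  unfolding walk_def by (auto simp: hd_rev last_rev insert_commute)

lemma walk_last: "walk u xs v \<Longrightarrow> xs = butlast xs @ [v]"
  unfolding walk_def using append_butlast_last_id[of xs] by simp

lemma walk_hd: "walk u xs v \<Longrightarrow> xs = u # tl xs"
  unfolding walk_def by (cases xs) auto

lemma dist_sym:
  assumes "u \<in> V" "v \<in> V" shows "d u v = d v u"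
proof -
  have "d b a \<le> d a b" if ab: "a \<in> V" "b \<in> V" for a b
  proof -
    obtain xs where "walk a xs b" "length xs = d a b + 1" using shortest_walk[OF ab] by blast
    then show ?thesis using dist_le_walk[OF walk_rev, of a xs b] by simp
  qed
  then show ?thesis using assms by (simp add: le_antisym)
qed

lemma dist_triangle:
  assumes "u \<in> V" "v \<in> V" "w \<in> V" shows "d u v \<le> d u w + d w v"
proof -
  obtain xs where xs: "walk u xs w" "length xs = d u w + 1" using shortest_walk assms by blast
  obtain ys where ys: "walk w ys v" "length ys = d w v + 1" using shortest_walk assms by blast
  have eqs: "xs = butlast xs @ [w]" "ys = w # tl ys"
    using walk_last[OF xs(1)] walk_hd[OF ys(1)] .
  have "walk u (butlast xs @ w # tl ys) v"
    using walk_append_iff[of u "butlast xs" w "tl ys" v] xs(1) ys(1) eqs by simp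
  from dist_le_walk[OF this] xs ys show ?thesis by simp
qed

text \<open>A geodesic through \<open>w\<close> splits there into two walks, and two geodesics
  meeting at \<open>w\<close> join to one walk. Intervals, and with them convexity, can thus be read
  off the distance matrix.\<close>

lemma interval_iff:
  assumes "u \<in> V" "v \<in> V" "w \<in> V"
  shows "(\<exists>xs. shortest_path V E u xs v \<and> w \<in> set xs) \<longleftrightarrow> d u w + d w v = d u v"
proof
  assume "\<exists>xs. shortest_path V E u xs v \<and> w \<in> set xs"
  then obtain as bs where *: "walk u (as @ w # bs) v" "length (as @ w # bs) = d u v + 1"
    unfolding shortest_path_iff by (metis split_list)
  then have "walk u (as @ [w]) w" "walk w (w # bs) v" using walk_append_iff by blast+
  from this[THEN dist_le_walk]
  have "d u w + d w v \<le> d u v" using *(2) by simp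
  then show "d u w + d w v = d u v" using dist_triangle assms by (simp add: le_antisym)
next
  assume eq: "d u w + d w v = d u v"
  obtain xs where xs: "walk u xs w" "length xs = d u w + 1" using shortest_walk assms by blast
  obtain ys where ys: "walk w ys v" "length ys = d w v + 1" using shortest_walk assms by blast
  have eqs: "xs = butlast xs @ [w]" "ys = w # tl ys"
    using walk_last[OF xs(1)] walk_hd[OF ys(1)] .
  have "walk u (butlast xs @ w # tl ys) v"
    using walk_append_iff[of u "butlast xs" w "tl ys" v] xs(1) ys(1) eqs by simp
  then show "\<exists>xs. shortest_path V E u xs v \<and> w \<in> set xs"
    unfolding shortest_path_iff using xs ys eq
    by (intro exI[of _ "butlast xs @ w # tl ys"]) simp
qed

lemma convex_iff:
  "convex_set V E X \<longleftrightarrow> X \<subseteq> V \<and>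
     (\<forall>u\<in>X. \<forall>v\<in>X. \<forall>w\<in>V. d u w + d w v = d u v \<longrightarrow> w \<in> X)"
proof -
  have "set xs \<subseteq> V" if "shortest_path V E u xs v" for u v xs
    using that unfolding shortest_path_iff walk_def by blast
  then show ?thesis unfolding convex_set_def using interval_iff by (smt (verit) subset_iff)
qed

section \<open>Recursion for distances, and parity in bipartite graphs\<close>

lemma dist_eq_0_iff:
  assumes "u \<in> V" "v \<in> V" shows "d u v = 0 \<longleftrightarrow> u = v"
proof
  assume "d u v = 0"
  then show "u = v" using shortest_walk[OF assms] unfolding walk_def
    by (metis One_nat_def add_0 length_0_conv length_Suc_conv last.simps list.sel(1))
next
  assume "u = v"
  then have "walk u [u] v" using assms unfolding walk_def by simp
  from dist_le_walk[OF this] show "d u v = 0" by simp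
qed

lemma dist_edge: "{u, v} \<in> E \<Longrightarrow> d u v \<le> 1"
  using dist_le_walk[of u "[u, v]" v] edgeD[of u v] unfolding walk_def by simp

text \<open>The vertex before \<open>v\<close> on a shortest walk works: the walk bounds its
  distance from above, the triangle inequality from below.\<close>

lemma dist_pred:
  assumes "u \<in> V" "v \<in> V" "d u v = Suc k"
  obtains w where "{w, v} \<in> E" "d u w = k"
proof -
  obtain xs where xs: "walk u xs v" "length xs = k + 2" using shortest_walk assms by (metis add_Suc_right add_2_eq_Suc' Suc_eq_plus1)
  obtain ys w where "xs = ys @ [w, v]"
  proof -
    have "xs = butlast xs @ [v]" using walk_last[OF xs(1)] .
    moreover have "butlast xs \<noteq> []" using xs by (cases xs) auto
    ultimately show thesis using that by (metis append_butlast_last_id append_Cons append_Nil append_assoc)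
  qed
  with xs have w: "walk u (ys @ [w]) w" "{w, v} \<in> E"
    using walk_append_iff[of u ys w "[v]" v] unfolding walk_def by auto
  have "d u w \<le> k" using dist_le_walk[OF w(1)] xs \<open>xs = _\<close> by simp
  moreover have "d u v \<le> d u w + 1"
    using dist_triangle[OF assms(1,2)] dist_edge[OF w(2)] edgeD[OF w(2)] by (meson add_left_mono le_trans)
  ultimately show thesis using that w assms(3) by simp
qed

text \<open>A geodesic repeats no vertex. This bounds the number of rounds of the breadth-first
  search.\<close>

lemma dist_less_card:
  assumes "u \<in> V" "v \<in> V" shows "d u v < card V"
proof -
  obtain xs where xs: "walk u xs v" "length xs = d u v + 1" using shortest_walk assms by blast
  then have "distinct xs" "set xs \<subseteq> V"
    using shortest_path_iff path_iff unfolding shortest_path_def walk_def by blast+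
  moreover have "finite V" using simple simple_graph_def by blast
  ultimately show ?thesis using xs(2) by (metis Suc_eq_plus1 Suc_le_eq card_mono distinct_card)
qed

text \<open>The test made in round \<open>k\<close> of the breadth-first search: the lower bound
  says that earlier rounds did not reach \<open>v\<close>, and a neighbour at distance
  \<open>k - 1\<close> supplies the upper bound.\<close>

lemma dist_step_iff:
  assumes "u \<in> V" "v \<in> V"
  shows "d u v = k \<longleftrightarrow> k \<le> d u v \<and> (if k = 0 then u = v else \<exists>w. {w, v} \<in> E \<and> d u w = k - 1)"
proof (cases k)
  case 0 then show ?thesis using dist_eq_0_iff assms by simp
next
  case (Suc j)
  have "d u v \<le> Suc j" if "{w, v} \<in> E" "d u w = j" for w
    using dist_triangle[OF assms, of w] dist_edge[OF that(1)] edgeD[OF that(1)] that(2) by simp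
  moreover have "\<exists>w. {w, v} \<in> E \<and> d u w = j" if "d u v = Suc j"
    using dist_pred[OF assms that] by blast
  ultimately show ?thesis using Suc by (auto intro: le_antisym)
qed

text \<open>Every step back along a geodesic changes sides.\<close>

lemma bipartite_parity:
  assumes "A \<union> B = V" "A \<inter> B = {}" "\<forall>e\<in>E. joins e A B" "u \<in> V" "v \<in> V"
  shows "even (d u v) \<longleftrightarrow> (u \<in> A \<longleftrightarrow> v \<in> A)"
  using assms(5)
proof (induction "d u v" arbitrary: v)
  case 0
  then have "u = v" using dist_eq_0_iff[OF assms(4), of v] by simp
  with 0 show ?case by simp
next
  case (Suc k)
  obtain w where w: "{w, v} \<in> E" "d u w = k" using dist_pred[OF assms(4) Suc.prems] Suc.hyps(2) by metis
  then have "joins {w, v} A B" "w \<in> V" using assms(3) edgeD by blast+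
  then have "w \<in> A \<longleftrightarrow> v \<notin> A" using assms(2) unfolding joins_def doubleton_eq_iff by blast
  then show ?case using Suc.hyps(1)[of w] Suc.hyps(2) w \<open>w \<in> V\<close> by (metis even_Suc)
qed

text \<open>The ends of an edge lie on opposite sides, so their distances from \<open>w\<close>
  differ in parity.\<close>

lemma bipartite_dist_edge_neq:
  assumes "bipartite V E" "{x, y} \<in> E" "w \<in> V"
  shows "d w x \<noteq> d w y"
proof -
  obtain A B where AB: "A \<union> B = V" "A \<inter> B = {}" "\<forall>e\<in>E. joins e A B"
    using assms(1) unfolding bipartite_def by blast
  then have "x \<in> A \<longleftrightarrow> y \<notin> A"
    using assms(2) unfolding joins_def by (metis IntI doubleton_eq_iff empty_iff)
  then show ?thesis using bipartite_parity[OF AB assms(3)] edgeD[OF assms(2)] by metis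
qed

end

section \<open>Uniqueness\<close>

lemma convex_partition_cover:
  assumes "convex_partition V E p X" "v \<in> V" obtains i where "i \<in> {1..p}" "v \<in> X i"
  using assms partition_onD1[of V "X ` {1..p}"] unfolding convex_partition_def by blast

lemma convex_partition_unique_index:
  assumes "convex_partition V E p X" "i \<in> {1..p}" "j \<in> {1..p}" "v \<in> X i" "v \<in> X j"
  shows "i = j"
proof -
  have "disjoint (X ` {1..p})" "inj_on X {1..p}"
    using assms(1) partition_onD2 unfolding convex_partition_def by blast+
  then have "X i = X j" using assms(2-5) unfolding disjoint_def by blast
  then show ?thesis using \<open>inj_on X {1..p}\<close> assms(2,3) by (meson inj_onD)
qed

lemma convex_partition_subset:
  "convex_partition V E p X \<Longrightarrow> i \<in> {1..p} \<Longrightarrow> X i \<subseteq> V"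
  unfolding convex_partition_def convex_set_def by blast

lemma convex_partition_nonempty:
  assumes "convex_partition V E p X" "i \<in> {1..p}" shows "X i \<noteq> {}"
proof
  assume "X i = {}"
  then have "{} \<in> X ` {1..p}" using assms(2) by (metis image_eqI)
  then show False using assms(1) partition_onD3 unfolding convex_partition_def by blast
qed

text \<open>A family of parts is a function on all naturals, arbitrary outside
  \<open>{1..p}\<close>. This and \<open>skeleton_cong\<close> transfer properties between families
  that agree on the indices.\<close>

lemma convex_partition_cong:
  assumes "\<And>i. i \<in> {1..p} \<Longrightarrow> X i = Y i"
  shows "convex_partition V E p X \<longleftrightarrow> convex_partition V E p Y"
proof -
  have "X ` {1..p} = Y ` {1..p}" "inj_on X {1..p} \<longleftrightarrow> inj_on Y {1..p}"
    using assms using inj_on_cong[of "{1..p}" X Y] image_cong[of "{1..p}" _ X Y] by blast+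
  then show ?thesis unfolding convex_partition_def using assms by simp
qed

lemma skeleton_cong:
  assumes "\<And>i. i \<in> {1..p} \<Longrightarrow> X i = Y i"
  shows "skeleton E p X F \<phi> \<longleftrightarrow> skeleton E p Y F \<phi>"
  unfolding skeleton_def using assms by simp

context connected_simple_graph
begin

text \<open>The \<open>i\<close>-side for \<open>i = \<phi> a\<close>. Each edge of \<open>F\<close>
  is met in both orientations; the condition on \<open>\<phi> x\<close> selects the relevant
  one.\<close>

definition nearer :: "'a set set \<Rightarrow> ('a \<Rightarrow> nat) \<Rightarrow> 'a \<Rightarrow> 'a \<Rightarrow> bool" where
  "nearer F \<phi> a w \<longleftrightarrow> (\<forall>x\<in>V. \<forall>y\<in>V. {x, y} \<in> F \<and> \<phi> x = \<phi> a \<longrightarrow> d w x < d w y)"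

definition attracted :: "'a set set \<Rightarrow> ('a \<Rightarrow> nat) \<Rightarrow> 'a \<Rightarrow> 'a \<Rightarrow> bool" where
  "attracted F \<phi> a v \<longleftrightarrow> (\<forall>w\<in>V. d v w + d w a = d v a \<longrightarrow> nearer F \<phi> a w)"

end

section \<open>Parts of a convex partition with a given skeleton, described by distances\<close>

locale skeleton_partition = connected_simple_graph V E
  for V :: "'a set" and E +
  fixes p :: nat and X :: "nat \<Rightarrow> 'a set" and F :: "'a set set" and \<phi> :: "'a \<Rightarrow> nat"
  assumes bipartite: "bipartite V E"
    and part: "convex_partition V E p X"
    and skel: "skeleton E p X F \<phi>"
begin

lemma F_edge: "{x, y} \<in> F \<Longrightarrow> {x, y} \<in> E"
  using skel unfolding skeleton_def by blast

lemma root_in_part: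
  assumes "a \<in> \<Union>F" shows "\<phi> a \<in> {1..p}" "a \<in> X (\<phi> a)"
  using assms skel unfolding skeleton_def by blast+

lemma root_unique: "a \<in> \<Union>F \<Longrightarrow> i \<in> {1..p} \<Longrightarrow> a \<in> X i \<Longrightarrow> \<phi> a = i"
  using skel unfolding skeleton_def by blast

text \<open>An edge of \<open>F\<close> joins two distinct parts, and \<open>\<phi>\<close> names
  the part of each end.\<close>

lemma F_edge_leaves:
  assumes "{x, y} \<in> F" shows "y \<notin> X (\<phi> x)"
proof -
  obtain i j a b where ij: "i \<in> {1..p}" "j \<in> {1..p}" "i \<noteq> j" "a \<in> X i" "b \<in> X j" "{x, y} = {a, b}"
    using assms skel unfolding skeleton_def joins_def by meson
  have r: "x \<in> \<Union>F" "y \<in> \<Union>F" using assms by blast+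
  then have "a \<in> \<Union>F" "b \<in> \<Union>F" using ij(6) by (metis doubleton_eq_iff)+
  then have "\<phi> a = i" "\<phi> b = j" using root_unique[of a i] root_unique[of b j] ij by simp_all
  then have "\<phi> x \<noteq> \<phi> y" using ij(3,6) by (metis doubleton_eq_iff)
  then show ?thesis using root_unique[OF r(2) root_in_part(1)[OF r(1)]] by metis
qed

text \<open>If \<open>y\<close> were nearer to \<open>w\<close> than \<open>x\<close>, it would lie
  on a geodesic from \<open>w\<close> to \<open>x\<close>. Both of these are in the part, so
  convexity would put \<open>y\<close> there too, although the edge leaves the part. Bipartiteness
  excludes a tie.\<close>

lemma part_nearer:
  assumes "a \<in> \<Union>F" "w \<in> X (\<phi> a)" shows "nearer F \<phi> a w"
  unfolding nearer_def
proof (intro ballI impI, elim conjE)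
  fix x y assume xy: "x \<in> V" "y \<in> V" "{x, y} \<in> F" "\<phi> x = \<phi> a"
  have i: "\<phi> a \<in> {1..p}" using root_in_part assms(1) by blast
  have w: "w \<in> V" using convex_partition_subset[OF part i] assms(2) by blast
  have x: "x \<in> X (\<phi> a)" using root_in_part(2)[of x] xy by auto
  show "d w x < d w y"
  proof (rule ccontr)
    assume "\<not> d w x < d w y"
    then have less: "d w y < d w x"
      using bipartite_dist_edge_neq[OF bipartite F_edge[OF xy(3)] w] by simp
    have "d y x \<le> 1" using dist_edge[of y x] F_edge[OF xy(3)] by (simp add: insert_commute)
    then have "d w y + d y x = d w x" using less dist_triangle[OF w xy(1,2)] by simp
    then have "y \<in> X (\<phi> a)"
      using part i assms(2) x xy(2) unfolding convex_partition_def convex_iff by blast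
    then show False using F_edge_leaves[OF xy(3)] xy(4) by simp
  qed
qed

lemma skeleton_edge:
  assumes "i \<in> {1..p}" "j \<in> {1..p}" "i \<noteq> j" "{u, v} \<in> E" "u \<in> X i" "v \<in> X j"
  obtains x y where "{x, y} \<in> F" "\<phi> x = i" "\<phi> y = j"
proof -
  have "\<exists>e\<in>E. joins e (X i) (X j)" using assms(4-6) unfolding joins_def by blast
  then obtain e where "e \<in> F" "joins e (X i) (X j)"
    using skel assms(1-3) unfolding skeleton_def by metis
  then obtain x y where xy: "{x, y} \<in> F" "x \<in> X i" "y \<in> X j" unfolding joins_def by blast
  then show thesis using that[OF xy(1)] root_unique assms(1,2) by blast
qed

lemma part_iff_attracted:
  assumes a: "a \<in> \<Union>F" and v: "v \<in> V"
  shows "v \<in> X (\<phi> a) \<longleftrightarrow> attracted F \<phi> a v"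
proof
  have i: "\<phi> a \<in> {1..p}" and aX: "a \<in> X (\<phi> a)" using root_in_part a by blast+
  show "attracted F \<phi> a v" if "v \<in> X (\<phi> a)"
    unfolding attracted_def
    using part i that aX part_nearer[OF a] unfolding convex_partition_def convex_iff by blast
  have aV: "a \<in> V" using aX convex_partition_subset[OF part i] by blast
  show "v \<in> X (\<phi> a)" if att: "attracted F \<phi> a v"
  proof (rule ccontr)
    assume "v \<notin> X (\<phi> a)"
    \<comment> \<open>The last vertex outside the part on a geodesic from \<open>v\<close> to \<open>a\<close>.\<close>
    let ?P = "\<lambda>w. w \<in> V \<and> w \<notin> X (\<phi> a) \<and> d v w + d w a = d v a"
    have "?P v" using v \<open>v \<notin> X (\<phi> a)\<close> dist_eq_0_iff[OF v v] by simp
    then obtain w where w: "?P w" and min: "\<And>z. ?P z \<Longrightarrow> d w a \<le> d z a"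
      using ex_has_least_nat[of ?P v "\<lambda>z. d z a"] by blast
    have "d a w \<noteq> 0" using w aX dist_eq_0_iff[OF aV, of w] by blast
    then obtain z where z: "{z, w} \<in> E" "d a w = Suc (d a z)"
      using dist_pred[OF aV, of w] w by (metis not0_implies_Suc)
    have zV: "z \<in> V" using edgeD z(1) by blast
    have wz: "d w a = Suc (d z a)" using dist_sym[OF aV] z(2) w zV by simp
    \<comment> \<open>The vertex \<open>z\<close> is one step closer to \<open>a\<close> and still
      on a geodesic from \<open>v\<close> to \<open>a\<close>, so the minimality of \<open>w\<close>
      places it inside the part.\<close>
    have "d v z \<le> d v w + 1"
      using dist_triangle[OF v zV, of w] dist_edge[of w z] w z(1) by (simp add: insert_commute)
    moreover have "d v a \<le> d v z + d z a" using dist_triangle[OF v aV zV] .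
    ultimately have "d v z + d z a = d v a" using w wz by simp
    then have zX: "z \<in> X (\<phi> a)" using min[of z] wz zV by fastforce
    \<comment> \<open>The edge \<open>zw\<close> runs between two parts, so \<open>F\<close> has an
      edge \<open>xy\<close> between them. Attraction puts \<open>w\<close> nearer to
      \<open>x\<close>, membership in \<open>X j\<close> puts it nearer to \<open>y\<close>.\<close>
    obtain j where j: "j \<in> {1..p}" "w \<in> X j" using convex_partition_cover[OF part] w by blast
    then have "\<phi> a \<noteq> j" using w by blast
    then obtain x y where xy: "{x, y} \<in> F" "\<phi> x = \<phi> a" "\<phi> y = j"
      using skeleton_edge[OF i j(1) _ z(1) zX j(2)] by blast
    have xyV: "x \<in> V" "y \<in> V" using edgeD F_edge[OF xy(1)] by blast+
    have "d w x < d w y"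
      using att w xy xyV unfolding attracted_def nearer_def by blast
    moreover have "nearer F \<phi> y w" using part_nearer[of y w] xy j(2) by blast
    then have "d w y < d w x"
      using xy(1) xyV unfolding nearer_def by (simp add: insert_commute)
    ultimately show False by simp
  qed
qed

text \<open>By connectedness some edge leaves \<open>X i\<close>, namely at a vertex outside that is
  nearest to a fixed vertex of the part. The skeleton edge between the same two parts has an end
  labelled \<open>i\<close>.\<close>

lemma part_has_root:
  assumes "i \<in> {1..p}" "V \<noteq> X i" obtains a where "a \<in> \<Union>F" "\<phi> a = i"
proof -
  have "X i \<noteq> {}" "X i \<subseteq> V"
    using convex_partition_nonempty[OF part assms(1)] convex_partition_subset[OF part assms(1)] .
  then obtain u v where u: "u \<in> X i" "u \<in> V" and v: "v \<in> V \<and> v \<notin> X i" using assms(2) by blast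
  then obtain w where w: "w \<in> V \<and> w \<notin> X i" and min: "\<And>z. z \<in> V \<and> z \<notin> X i \<Longrightarrow> d u w \<le> d u z"
    using ex_has_least_nat[of "\<lambda>z. z \<in> V \<and> z \<notin> X i" v "d u"] by blast
  have "d u w \<noteq> 0" using w u dist_eq_0_iff by blast
  then obtain z where z: "{z, w} \<in> E" "d u w = Suc (d u z)"
    using dist_pred[OF u(2), of w] w by (metis not0_implies_Suc)
  have "z \<in> X i" using min[of z] z edgeD[OF z(1)] by fastforce
  obtain j where j: "j \<in> {1..p}" "w \<in> X j" using convex_partition_cover[OF part] w by blast
  then obtain x y where "{x, y} \<in> F" "\<phi> x = i"
    using skeleton_edge[OF assms(1) j(1) _ z(1) \<open>z \<in> X i\<close> j(2)] w by blast
  then show thesis using that by blast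
qed

text \<open>If one part is all of \<open>V\<close>, nonemptiness leaves no other index, so
  \<open>F\<close> is empty and there are no roots. Otherwise the part has a root, and any root of
  it decides membership.\<close>

lemma part_iff:
  assumes "i \<in> {1..p}" "v \<in> V"
  shows "v \<in> X i \<longleftrightarrow> F = {} \<or> (\<exists>a\<in>\<Union>F. \<phi> a = i \<and> attracted F \<phi> a v)"
proof (cases "V = X i")
  case True
  have "j = i" if j: "j \<in> {1..p}" for j
  proof -
    obtain z where "z \<in> X j" using convex_partition_nonempty[OF part j] by blast
    moreover have "z \<in> X i" using \<open>z \<in> X j\<close> True convex_partition_subset[OF part j] by blast
    ultimately show ?thesis using convex_partition_unique_index[OF part j assms(1)] by blast
  qed
  then have "F = {}" using skel unfolding skeleton_def by (metis equals0I)
  then show ?thesis using True assms(2) by blast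
next
  case False
  then obtain a where a: "a \<in> \<Union>F" "\<phi> a = i" using part_has_root assms(1) by blast
  then have "F \<noteq> {}" by blast
  then show ?thesis using a part_iff_attracted[OF _ assms(2)] by metis
qed

end

theorem skeleton_partition_unique:
  assumes "skeleton_partition V E p X F \<phi>" "skeleton_partition V E p Y F \<phi>" "i \<in> {1..p}"
  shows "X i = Y i"
proof -
  interpret X: skeleton_partition V E p X F \<phi> by fact
  interpret Y: skeleton_partition V E p Y F \<phi> by fact
  have "X i \<subseteq> V" "Y i \<subseteq> V"
    using convex_partition_subset[OF X.part assms(3)] convex_partition_subset[OF Y.part assms(3)] .
  moreover have "v \<in> X i \<longleftrightarrow> v \<in> Y i" if "v \<in> V" for v
    unfolding X.part_iff[OF assms(3) that] Y.part_iff[OF assms(3) that] ..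
  ultimately show ?thesis by blast
qed

section \<open>Checking a labelling\<close>

text \<open>All quantifiers are bounded by \<open>n\<close>, so that a program can evaluate them;
  \<open>p \<le> n\<close> makes this harmless for the indices. Then follow nonemptiness, convexity,
  the labels along \<open>F\<close>, and existence and uniqueness of the skeleton edge between two
  adjacent parts.\<close>

definition valid_labelling ::
  "nat \<Rightarrow> nat set set \<Rightarrow> nat \<Rightarrow> nat set set \<Rightarrow> (nat \<Rightarrow> nat) \<Rightarrow> (nat \<Rightarrow> nat) \<Rightarrow> bool" where
  "valid_labelling n E p F \<phi> L \<longleftrightarrow>
     p \<le> n \<and> (\<forall>i<n. i < p \<longrightarrow> (\<exists>v<n. L v = i + 1)) \<and>
     (\<forall>u<n. \<forall>v<n. L u = L v \<longrightarrow> (\<forall>w<n.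
        graph_dist {..<n} E u w + graph_dist {..<n} E w v = graph_dist {..<n} E u v \<longrightarrow> L w = L u)) \<and>
     (\<forall>u<n. \<forall>v<n. {u, v} \<in> F \<longrightarrow> L u \<noteq> L v \<and> L u = \<phi> u) \<and>
     (\<forall>u<n. \<forall>v<n. {u, v} \<in> E \<and> L u \<noteq> L v \<longrightarrow>
        (\<exists>x<n. \<exists>y<n. {x, y} \<in> F \<and> L x = L u \<and> L y = L v)) \<and>
     (\<forall>u<n. \<forall>v<n. {u, v} \<in> F \<longrightarrow> (\<forall>x<n. \<forall>y<n. {x, y} \<in> F \<and> L x = L u \<and> L y = L v \<longrightarrow>
        x = u \<and> y = v))"

lemma valid_labelling_iff:
  assumes "simple_graph {..<n} E" "connected_graph {..<n} E" "F \<subseteq> E" "\<phi> \<in> \<Union>F \<rightarrow> {1..p}"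
    and L: "\<And>v. v < n \<Longrightarrow> L v \<in> {1..p}"
  defines "X \<equiv> \<lambda>i. {v \<in> {..<n}. L v = i}"
  shows "valid_labelling n E p F \<phi> L \<longleftrightarrow> convex_partition {..<n} E p X \<and> skeleton E p X F \<phi>"
proof -
  interpret connected_simple_graph "{..<n}" E using assms(1,2) by unfold_locales
  have edge: "u < n \<and> v < n" if "{u, v} \<in> E" for u v using edgeD[OF that] by simp
  have joins: "joins e (X i) (X j) \<longleftrightarrow> (\<exists>u<n. \<exists>v<n. e = {u, v} \<and> L u = i \<and> L v = j)" for e i j
    unfolding joins_def X_def by auto
  have "{1..p} \<subseteq> L ` {..<n} \<longleftrightarrow> p \<le> n \<and> (\<forall>i<n. i < p \<longrightarrow> (\<exists>v<n. L v = i + 1))"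
  proof
    assume *: "{1..p} \<subseteq> L ` {..<n}"
    then have "card {1..p} \<le> card {..<n}" by (meson surj_card_le finite_lessThan)
    moreover have "\<exists>v<n. L v = i + 1" if "i < p" for i
    proof -
      have "i + 1 \<in> {1..p}" using that by simp
      then have "i + 1 \<in> L ` {..<n}" using * by blast
      then show ?thesis by auto
    qed
    ultimately show "p \<le> n \<and> (\<forall>i<n. i < p \<longrightarrow> (\<exists>v<n. L v = i + 1))" by simp
  next
    assume *: "p \<le> n \<and> (\<forall>i<n. i < p \<longrightarrow> (\<exists>v<n. L v = i + 1))"
    show "{1..p} \<subseteq> L ` {..<n}"
    proof
      fix i assume "i \<in> {1..p}"
      then have "i - 1 < n" "i - 1 < p" "i = i - 1 + 1" using * by auto
      then show "i \<in> L ` {..<n}" using * by (metis image_eqI lessThan_iff)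
    qed
  qed
  \<comment> \<open>Label classes are always disjoint and cover the vertices, and nonempty classes
    of different labels differ. Only nonemptiness depends on surjectivity.\<close>
  moreover have "{1..p} \<subseteq> L ` {..<n} \<longleftrightarrow> partition_on {..<n} (X ` {1..p}) \<and> inj_on X {1..p}"
  proof
    assume *: "{1..p} \<subseteq> L ` {..<n}"
    have ne: "X i \<noteq> {}" if "i \<in> {1..p}" for i using * that unfolding X_def by auto
    have "partition_on {..<n} (X ` {1..p})"
    proof (rule partition_onI)
      show "\<Union>(X ` {1..p}) = {..<n}" using L unfolding X_def by auto
      show "disjnt A B" if "A \<in> X ` {1..p}" "B \<in> X ` {1..p}" "A \<noteq> B" for A B
        using that unfolding X_def disjnt_def by auto
    qed (use ne in blast)
    moreover have "inj_on X {1..p}"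
      using ne unfolding inj_on_def X_def by blast
    ultimately show "partition_on {..<n} (X ` {1..p}) \<and> inj_on X {1..p}" ..
  next
    assume "partition_on {..<n} (X ` {1..p}) \<and> inj_on X {1..p}"
    then have "X i \<noteq> {}" if "i \<in> {1..p}" for i using partition_onD3 that by fastforce
    then show "{1..p} \<subseteq> L ` {..<n}" unfolding X_def by fast
  qed
  moreover have "(\<forall>i\<in>{1..p}. convex_set {..<n} E (X i)) \<longleftrightarrow>
      (\<forall>u<n. \<forall>v<n. L u = L v \<longrightarrow> (\<forall>w<n. d u w + d w v = d u v \<longrightarrow> L w = L u))"
    (is "_ \<longleftrightarrow> ?C")
  proof
    assume *: "\<forall>i\<in>{1..p}. convex_set {..<n} E (X i)"
    show ?C
    proof (intro allI impI)
      fix u v w assume uvw: "u < n" "v < n" "L u = L v" "w < n" "d u w + d w v = d u v"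
      have "convex_set {..<n} E (X (L u))" using * L[OF uvw(1)] by blast
      moreover have "u \<in> X (L u)" "v \<in> X (L u)" "w \<in> {..<n}" using uvw unfolding X_def by auto
      ultimately have "w \<in> X (L u)" using uvw(5) unfolding convex_iff by blast
      then show "L w = L u" unfolding X_def by simp
    qed
  next
    assume C: ?C
    have "convex_set {..<n} E (X i)" for i
      unfolding convex_iff
    proof (intro conjI ballI impI)
      fix u v w assume "u \<in> X i" "v \<in> X i" "w \<in> {..<n}" "d u w + d w v = d u v"
      then show "w \<in> X i" using C[rule_format, of u v w] unfolding X_def by simp
    qed (auto simp: X_def)
    then show "\<forall>i\<in>{1..p}. convex_set {..<n} E (X i)" by blast
  qed
  moreover have "skeleton E p X F \<phi> \<longleftrightarrow>
     (\<forall>u<n. \<forall>v<n. {u, v} \<in> F \<longrightarrow> L u \<noteq> L v \<and> L u = \<phi> u) \<and>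
     (\<forall>u<n. \<forall>v<n. {u, v} \<in> E \<and> L u \<noteq> L v \<longrightarrow>
        (\<exists>x<n. \<exists>y<n. {x, y} \<in> F \<and> L x = L u \<and> L y = L v)) \<and>
     (\<forall>u<n. \<forall>v<n. {u, v} \<in> F \<longrightarrow> (\<forall>x<n. \<forall>y<n. {x, y} \<in> F \<and> L x = L u \<and> L y = L v \<longrightarrow>
        x = u \<and> y = v))" (is "_ \<longleftrightarrow> ?R")
  proof
    assume skel: "skeleton E p X F \<phi>"
    have ne: "L u \<noteq> L v" if "{u, v} \<in> F" for u v
    proof -
      have "\<exists>i\<in>{1..p}. \<exists>j\<in>{1..p}. i \<noteq> j \<and> joins {u, v} (X i) (X j)"
        using skel that unfolding skeleton_def by blast
      then obtain x y where "{u, v} = {x, y}" "L x \<noteq> L y" unfolding joins by blast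
      then show ?thesis by (metis doubleton_eq_iff)
    qed
    have phi: "L u = \<phi> u" if "u < n" "u \<in> \<Union>F" for u
    proof -
      have "\<phi> u \<in> {1..p}" using that assms(4) by blast
      then have "u \<in> X (\<phi> u)" using skel that unfolding skeleton_def by blast
      then show ?thesis unfolding X_def by simp
    qed
    have ex1: "\<exists>!e. e \<in> F \<and> joins e (X (L u)) (X (L v))" if "{u, v} \<in> E" "L u \<noteq> L v" for u v
    proof -
      have "L u \<in> {1..p}" "L v \<in> {1..p}" using edge[OF that(1)] L by blast+
      moreover have "joins {u, v} (X (L u)) (X (L v))" unfolding joins using edge[OF that(1)] by blast
      ultimately show ?thesis using skel that unfolding skeleton_def by blast
    qed
    show ?R
    proof (intro conjI allI impI)
      fix u v assume "{u, v} \<in> E \<and> L u \<noteq> L v"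
      then obtain e where "e \<in> F" "joins e (X (L u)) (X (L v))" using ex1 by blast
      then show "\<exists>x<n. \<exists>y<n. {x, y} \<in> F \<and> L x = L u \<and> L y = L v" unfolding joins by blast
    next
      fix u v x y
      assume *: "u < n" "v < n" "x < n" "y < n" "{u, v} \<in> F" "{x, y} \<in> F \<and> L x = L u \<and> L y = L v"
      have "joins {u, v} (X (L u)) (X (L v))" "joins {x, y} (X (L u)) (X (L v))"
        unfolding joins using * by blast+
      moreover have "{u, v} \<in> E" using * assms(3) by blast
      ultimately have "{u, v} = {x, y}" using ex1[OF _ ne] * by blast
      \<comment> \<open>Equal edges may list their ends in opposite order; different labels at the
        two ends rule this out.\<close>
      then have "x = u \<and> y = v \<or> x = v \<and> y = u" unfolding doubleton_eq_iff by blast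
      then show "x = u" "y = v" using ne * by metis+
    qed (use ne phi in blast)+
  next
    assume R: ?R
    have F: "\<exists>u<n. \<exists>v<n. e = {u, v}" if "e \<in> F" for e
      using that assms(3) edgeE[of e] by (metis subsetD lessThan_iff)
    \<comment> \<open>The condition compares \<open>L\<close> with \<open>\<phi>\<close> at the
      first end only, but every end of an edge can be listed first.\<close>
    have LF: "L u = \<phi> u" "u < n" if u: "u \<in> \<Union>F" for u
    proof -
      obtain e where "e \<in> F" "u \<in> e" using u by blast
      then obtain v where "{u, v} \<in> F" using F[of e] by (metis insertE insert_commute singletonD)
      then show "L u = \<phi> u" "u < n" using R edge assms(3) by blast+
    qed
    show "skeleton E p X F \<phi>"
      unfolding skeleton_def
    proof (intro conjI ballI impI)
      fix e assume "e \<in> F"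
      then obtain u v where uv: "e = {u, v}" "u < n" "v < n" using F by blast
      have "L u \<noteq> L v" using R \<open>e \<in> F\<close> uv by blast
      moreover have "joins e (X (L u)) (X (L v))" unfolding joins using uv by blast
      ultimately show "\<exists>i\<in>{1..p}. \<exists>j\<in>{1..p}. i \<noteq> j \<and> joins e (X i) (X j)"
        using L uv(2,3) by blast
    next
      fix i j assume "i \<in> {1..p}" "j \<in> {1..p}" "i \<noteq> j" "\<exists>e\<in>E. joins e (X i) (X j)"
      then obtain u v where uv: "u < n" "v < n" "{u, v} \<in> E" "L u = i" "L v = j"
        unfolding joins by blast
      then obtain x y where xy: "x < n" "y < n" "{x, y} \<in> F" "L x = i" "L y = j"
        using R \<open>i \<noteq> j\<close> by metis
      show "\<exists>!e. e \<in> F \<and> joins e (X i) (X j)"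
      proof (rule ex1I[of _ "{x, y}"])
        show "{x, y} \<in> F \<and> joins {x, y} (X i) (X j)" unfolding joins using xy by blast
      next
        fix e assume "e \<in> F \<and> joins e (X i) (X j)"
        then obtain a b where "a < n" "b < n" "e = {a, b}" "{a, b} \<in> F" "L a = i" "L b = j"
          unfolding joins by blast
        then have "a = x \<and> b = y" using R xy by metis
        then show "e = {x, y}" using \<open>e = {a, b}\<close> by simp
      qed
    next
      fix v i assume "v \<in> \<Union>F" "i \<in> {1..p}"
      then show "\<phi> v = i \<longleftrightarrow> v \<in> X i" using LF[of v] unfolding X_def by auto
    qed (use assms(3,4) in auto)
  qed
  ultimately show ?thesis
    unfolding valid_labelling_def convex_partition_def by argo
qed

section \<open>The candidate labelling\<close>

context connected_simple_graph
begin

text \<open>A fold, because this is what the inner loop of the program computes: later attracting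
  roots overwrite earlier ones. The default 1 is right for \<open>F = {}\<close>, where only a
  partition with a single part is possible.\<close>

definition root_label :: "'a set set \<Rightarrow> ('a \<Rightarrow> nat) \<Rightarrow> 'a list \<Rightarrow> 'a \<Rightarrow> nat" where
  "root_label F \<phi> as v = fold (\<lambda>a l. if a \<in> \<Union>F \<and> attracted F \<phi> a v then \<phi> a else l) as 1"

lemma root_label_cases:
  "(\<exists>a\<in>set as. a \<in> \<Union>F \<and> attracted F \<phi> a v \<and> root_label F \<phi> as v = \<phi> a) \<or>
   root_label F \<phi> as v = 1 \<and> (\<forall>a\<in>set as. \<not> (a \<in> \<Union>F \<and> attracted F \<phi> a v))"
  unfolding root_label_def by (induction as rule: rev_induct) auto

lemma root_label_range:
  assumes "\<phi> \<in> \<Union>F \<rightarrow> {1..p}" "1 \<le> p" shows "root_label F \<phi> as v \<in> {1..p}"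
  using root_label_cases[of as F \<phi> v] assms by (auto simp: Pi_def)

end

lemma (in skeleton_partition) part_root_label:
  assumes "v \<in> V" "set as = V" "1 \<le> p" shows "v \<in> X (root_label F \<phi> as v)"
proof -
  have FV: "a \<in> V" if "a \<in> \<Union>F" for a
    using root_in_part[OF that] convex_partition_subset[OF part] by blast
  obtain i where i: "i \<in> {1..p}" "v \<in> X i" using convex_partition_cover[OF part assms(1)] .
  \<comment> \<open>Some part contains \<open>v\<close>, so by \<open>part_iff\<close> a root
    attracts it unless \<open>F\<close> is empty. The default survives only in that case.\<close>
  have "root_label F \<phi> as v = 1 \<and> F = {} \<or>
    (\<exists>a\<in>\<Union>F. attracted F \<phi> a v \<and> root_label F \<phi> as v = \<phi> a)"
    using root_label_cases[of as F \<phi> v] part_iff[OF i(1) assms(1)] i(2) FV assms(2) by blast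
  then show ?thesis
  proof
    assume "root_label F \<phi> as v = 1 \<and> F = {}"
    then have "root_label F \<phi> as v = 1" "F = {}" by blast+
    moreover have "v \<in> X 1" using part_iff[of 1 v] \<open>F = {}\<close> assms(1,3) by simp
    ultimately show ?thesis by metis
  next
    assume "\<exists>a\<in>\<Union>F. attracted F \<phi> a v \<and> root_label F \<phi> as v = \<phi> a"
    then show ?thesis using part_iff_attracted[OF _ assms(1)] by metis
  qed
qed

text \<open>One candidate is enough: a suitable partition \<open>Y\<close> has
  \<open>v \<in> Y (L v)\<close> by \<open>part_root_label\<close>, so its parts are the label
  classes. If these fail the check, there is no partition.\<close>

theorem valid_root_labelling_iff:
  fixes L :: "nat \<Rightarrow> nat"
  assumes "simple_graph {..<n} E" "connected_graph {..<n} E" "bipartite {..<n} E" "1 \<le> p"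
    "F \<subseteq> E" "\<phi> \<in> \<Union>F \<rightarrow> {1..p}"
    and L: "\<And>v. v < n \<Longrightarrow> L v = connected_simple_graph.root_label {..<n} E F \<phi> [0..<n] v"
  defines "X \<equiv> \<lambda>i. {v \<in> {..<n}. L v = i}"
  shows "if valid_labelling n E p F \<phi> L
    then convex_partition {..<n} E p X \<and> skeleton E p X F \<phi>
    else \<not> (\<exists>Y. convex_partition {..<n} E p Y \<and> skeleton E p Y F \<phi>)"
proof -
  interpret connected_simple_graph "{..<n}" E using assms(1,2) by unfold_locales
  have range: "L v \<in> {1..p}" if "v < n" for v
    using L[OF that] root_label_range assms(4,6) by simp
  have iff: "valid_labelling n E p F \<phi> L \<longleftrightarrow> convex_partition {..<n} E p X \<and> skeleton E p X F \<phi>"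
    unfolding X_def using valid_labelling_iff[OF assms(1,2,5,6)] range by blast
  have "convex_partition {..<n} E p X \<and> skeleton E p X F \<phi>"
    if Y: "convex_partition {..<n} E p Y" "skeleton E p Y F \<phi>" for Y
  proof -
    interpret skeleton_partition "{..<n}" E p Y F \<phi> using Y assms(3) by unfold_locales
    have LY: "v \<in> Y (L v)" if "v < n" for v
      using part_root_label[of v "[0..<n]"] L[OF that] that assms(4) by (simp add: atLeast0LessThan)
    have "X i = Y i" if i: "i \<in> {1..p}" for i
    proof (intro set_eqI iffI)
      fix v assume "v \<in> Y i"
      moreover from this have "v < n" using convex_partition_subset[OF Y(1) i] by blast
      ultimately show "v \<in> X i"
        using convex_partition_unique_index[OF Y(1) range i LY] unfolding X_def by blast
    qed (use LY X_def in blast)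
    then show ?thesis using Y convex_partition_cong skeleton_cong by metis
  qed
  then show ?thesis unfolding iff by (metis (full_types))
qed

section \<open>Bounded formulas as programs\<close>

text \<open>Total correctness from one start state. \<open>T\<close> is only an upper bound, so that
  branches of different cost can share it.\<close>

definition runs :: "prog \<Rightarrow> memory \<Rightarrow> nat \<Rightarrow> (memory \<Rightarrow> bool) \<Rightarrow> bool" where
  "runs P s T R \<longleftrightarrow> (\<exists>t s'. exec P s t s' \<and> t \<le> T \<and> R s')"

lemma runs_mono:
  assumes "runs P s T R" "T \<le> U" "\<And>s'. R s' \<Longrightarrow> Q s'" shows "runs P s U Q"
  using assms unfolding runs_def by (meson le_trans)

lemma runs_skip: "R s \<Longrightarrow> 1 \<le> T \<Longrightarrow> runs Skip s T R"
  unfolding runs_def using exec.Skip by blast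

lemma runs_assign:
  assumes "R (s(a := (s a)(expr_val e s := expr_val f s)))" "1 + expr_cost e + expr_cost f \<le> T"
  shows "runs (Assign a e f) s T R"
  using assms exec.Assign unfolding runs_def by blast

lemma runs_seq:
  assumes "runs P s T Q" "\<And>s'. Q s' \<Longrightarrow> runs P' s' U R" shows "runs (Seq P P') s (T + U) R"
proof -
  obtain t s' where "exec P s t s'" "t \<le> T" "Q s'" using assms(1) unfolding runs_def by blast
  moreover obtain u s'' where "exec P' s' u s''" "u \<le> U" "R s''"
    using assms(2)[OF \<open>Q s'\<close>] unfolding runs_def by blast
  ultimately show ?thesis unfolding runs_def using exec.Seq add_mono by metis
qed

lemma runs_cond:
  assumes "expr_val b s \<noteq> 0 \<Longrightarrow> runs P s T R" "expr_val b s = 0 \<Longrightarrow> runs Q s T R"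
  shows "runs (Cond b P Q) s (1 + expr_cost b + T) R"
proof (cases "expr_val b s = 0")
  case True
  then show ?thesis using assms(2) exec.CondFalse unfolding runs_def
    by (meson add_left_mono)
next
  case False
  then show ?thesis using assms(1) exec.CondTrue unfolding runs_def
    by (meson add_left_mono)
qed

lemma runs_while_stop:
  assumes "expr_val b s = 0" "R s" shows "runs (While b P) s (1 + expr_cost b) R"
  using assms exec.WhileFalse unfolding runs_def by blast

lemma runs_while_step:
  assumes "expr_val b s \<noteq> 0" "runs P s T Q" "\<And>s'. Q s' \<Longrightarrow> runs (While b P) s' U R"
  shows "runs (While b P) s (1 + expr_cost b + T + U) R"
proof -
  obtain t s' where "exec P s t s'" "t \<le> T" "Q s'" using assms(2) unfolding runs_def by blast
  moreover obtain u s'' where "exec (While b P) s' u s''" "u \<le> U" "R s''"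
    using assms(3)[OF \<open>Q s'\<close>] unfolding runs_def by blast
  ultimately have "exec (While b P) s (1 + expr_cost b + t + u) s''"
    "1 + expr_cost b + t + u \<le> 1 + expr_cost b + T + U" "R s''"
    using exec.WhileTrue assms(1) by (auto simp: add_mono)
  then show ?thesis unfolding runs_def by blast
qed

text \<open>Cell \<open>k\<close> of array 4 holds the variable bound by the \<open>k\<close>-th enclosing loop or quantifier,
  and cell 0 of array 5 the truth value of the formula evaluated last.\<close>

abbreviation bound :: expr where "bound \<equiv> Cell 0 (Lit 0)"
abbreviation var :: "nat \<Rightarrow> expr" where "var k \<equiv> Cell 4 (Lit k)"
abbreviation truth :: expr where "truth \<equiv> Cell 5 (Lit 0)"

definition set_var :: "nat \<Rightarrow> nat \<Rightarrow> memory \<Rightarrow> memory" where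
  "set_var k i s = s(4 := (s 4)(k := i))"

lemma set_var_apply [simp]:
  "set_var k i s 4 j = (if j = k then i else s 4 j)" "a \<noteq> 4 \<Longrightarrow> set_var k i s a = s a"
  unfolding set_var_def by auto

text \<open>The frame condition at nesting depth \<open>k\<close>: array 5 and the cells of array 4
  from \<open>k\<close> on are scratch space.\<close>

definition agree :: "nat \<Rightarrow> memory \<Rightarrow> memory \<Rightarrow> bool" where
  "agree k s s' \<longleftrightarrow> (\<forall>a. a \<noteq> 4 \<longrightarrow> a \<noteq> 5 \<longrightarrow> s' a = s a) \<and> (\<forall>j<k. s' 4 j = s 4 j)"

lemma agree_trans: "agree k s t \<Longrightarrow> agree k t u \<Longrightarrow> agree k s u"
  unfolding agree_def by simp

lemma agree_Suc: "agree (Suc k) s t \<Longrightarrow> agree k s t"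
  unfolding agree_def by simp

lemma agree_set_var_cong: "agree k s t \<Longrightarrow> agree (Suc k) (set_var k i s) (set_var k i t)"
  unfolding agree_def by (auto simp: less_Suc_eq)

lemma agree_set_var_Suc: "agree k s t \<Longrightarrow> t 4 k = i \<Longrightarrow> agree (Suc k) (set_var k i s) t"
  unfolding agree_def by (auto simp: less_Suc_eq)

lemma agree_truth: "agree k s (s(5 := x))"
  unfolding agree_def by simp

text \<open>Array 4 may be read only at literal indices, since a computed address could reach the
  scratch cells.\<close>

primrec wf_expr :: "nat \<Rightarrow> expr \<Rightarrow> bool" where
  "wf_expr k (Lit n) = True"
| "wf_expr k (Cell a e) = (if a = 4 then \<exists>j<k. e = Lit j else a \<noteq> 5 \<and> wf_expr k e)"
| "wf_expr k (Plus e f) = (wf_expr k e \<and> wf_expr k f)"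
| "wf_expr k (Monus e f) = (wf_expr k e \<and> wf_expr k f)"

lemma expr_val_agree: "wf_expr k e \<Longrightarrow> agree k s s' \<Longrightarrow> expr_val e s' = expr_val e s"
  by (induction e) (auto simp: agree_def split: if_splits)

section \<open>Bounded formulas and their evaluation in polynomial time\<close>

datatype formula =
    Atom expr
  | Neg formula
  | Conj formula formula
  | All formula

primrec wf_formula :: "nat \<Rightarrow> formula \<Rightarrow> bool" where
  "wf_formula k (Atom e) = wf_expr k e"
| "wf_formula k (Neg f) = wf_formula k f"
| "wf_formula k (Conj f g) = (wf_formula k f \<and> wf_formula k g)"
| "wf_formula k (All f) = wf_formula (Suc k) f"

primrec formula_val :: "nat \<Rightarrow> formula \<Rightarrow> memory \<Rightarrow> bool" where
  "formula_val k (Atom e) s = (expr_val e s \<noteq> 0)"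
| "formula_val k (Neg f) s = (\<not> formula_val k f s)"
| "formula_val k (Conj f g) s = (formula_val k f s \<and> formula_val k g s)"
| "formula_val k (All f) s = (\<forall>i<s 0 0. formula_val (Suc k) f (set_var k i s))"

text \<open>In \<open>Conj\<close> the \<open>Skip\<close> leaves the 0 of the failed first conjunct
  as the answer. \<open>All\<close> starts from truth value 1, which is correct for an empty
  range.\<close>

primrec test :: "nat \<Rightarrow> formula \<Rightarrow> prog" where
  "test k (Atom e) = Cond e (Assign 5 (Lit 0) (Lit 1)) (Assign 5 (Lit 0) (Lit 0))"
| "test k (Neg f) = Seq (test k f) (Assign 5 (Lit 0) (Monus (Lit 1) truth))"
| "test k (Conj f g) = Seq (test k f) (Cond truth (test k g) Skip)"
| "test k (All f) = Seq (Assign 5 (Lit 0) (Lit 1)) (Seq (Assign 4 (Lit k) (Lit 0))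
     (While (Monus bound (var k)) (Seq (test (Suc k) f)
        (Cond truth (Assign 4 (Lit k) (Plus (var k) (Lit 1))) (Assign 4 (Lit k) bound)))))"

text \<open>In the loop for \<open>All\<close>, a pass costs 6 for the guard and at most 9 for the
  branch with its assignment, besides the body. The 12 pays for two initial assignments and the
  final guard.\<close>

definition loop_time :: "nat poly \<Rightarrow> nat poly" where
  "loop_time q = [:0, 1:] * (q + [:15:]) + [:12:]"

lemma poly_loop_time [simp]: "poly (loop_time q) n = n * (poly q n + 15) + 12"
  unfolding loop_time_def by simp

primrec test_time :: "formula \<Rightarrow> nat poly" where
  "test_time (Atom e) = [:4 + expr_cost e:]"
| "test_time (Neg f) = test_time f + [:6:]"
| "test_time (Conj f g) = test_time f + test_time g + [:4:]"
| "test_time (All f) = loop_time (test_time f)"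

lemma formula_val_agree:
  "wf_formula k f \<Longrightarrow> agree k s s' \<Longrightarrow> formula_val k f s' = formula_val k f s"
proof (induction f arbitrary: k s s')
  case (Atom e)
  then show ?case using expr_val_agree by simp
next
  case (All f)
  have "s' 0 0 = s 0 0" using All.prems unfolding agree_def by simp
  then show ?case using All.IH[OF _ agree_set_var_cong] All.prems by simp
qed auto

text \<open>The nesting of loops depends on the formula alone, so for a fixed formula the time is
  polynomial in the bound.\<close>

theorem runs_test:
  "wf_formula k f \<Longrightarrow> s 0 0 = n \<Longrightarrow> runs (test k f) s (poly (test_time f) n)
     (\<lambda>s'. agree k s s' \<and> s' 5 0 = of_bool (formula_val k f s))"
proof (induction f arbitrary: k s)
  case (Atom e)
  have "runs (test k (Atom e)) s (1 + expr_cost e + 3)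
     (\<lambda>s'. agree k s s' \<and> s' 5 0 = of_bool (formula_val k (Atom e) s))"
    unfolding test.simps by (intro runs_cond runs_assign) (simp_all add: agree_truth)
  then show ?case by (rule runs_mono) auto
next
  case (Neg f)
  have "runs (test k (Neg f)) s (poly (test_time f) n + 6)
     (\<lambda>s'. agree k s s' \<and> s' 5 0 = of_bool (formula_val k (Neg f) s))"
    unfolding test.simps
  proof (rule runs_seq[OF Neg.IH])
    fix s' assume "agree k s s' \<and> s' 5 0 = of_bool (formula_val k f s)"
    then show "runs (Assign 5 (Lit 0) (Monus (Lit 1) truth)) s' 6
        (\<lambda>s'. agree k s s' \<and> s' 5 0 = of_bool (formula_val k (Neg f) s))"
      by (intro runs_assign) (auto simp: agree_def)
  qed (use Neg.prems in auto)
  then show ?case by simp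
next
  case (Conj f g)
  have "runs (test k (Conj f g)) s (poly (test_time f) n + (1 + expr_cost truth + (poly (test_time g) n + 1)))
     (\<lambda>s'. agree k s s' \<and> s' 5 0 = of_bool (formula_val k (Conj f g) s))"
    unfolding test.simps
  proof (rule runs_seq[OF Conj.IH(1)])
    fix s' assume s': "agree k s s' \<and> s' 5 0 = of_bool (formula_val k f s)"
    have g: "formula_val k g s' = formula_val k g s"
      using formula_val_agree Conj.prems(1) s' by simp
    have "runs (test k g) s' (poly (test_time g) n)
        (\<lambda>s'. agree k s s' \<and> s' 5 0 = of_bool (formula_val k (Conj f g) s))"
      if "formula_val k f s"
    proof (rule runs_mono[OF Conj.IH(2)])
      show "wf_formula k g" "s' 0 0 = n" using Conj.prems s' unfolding agree_def by auto
    qed (use s' agree_trans g that in auto)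
    then show "runs (Cond truth (test k g) Skip) s' (1 + expr_cost truth + (poly (test_time g) n + 1))
        (\<lambda>s'. agree k s s' \<and> s' 5 0 = of_bool (formula_val k (Conj f g) s))"
      using s' by (intro runs_cond) (auto intro: runs_skip runs_mono)
  qed (use Conj.prems in auto)
  then show ?case by (rule runs_mono) auto
next
  case (All f)
  let ?P = "\<lambda>i. formula_val (Suc k) f (set_var k i s)"
  let ?T = "poly (test_time f) n"
  let ?b = "Monus bound (var k)"
  let ?B = "Seq (test (Suc k) f)
    (Cond truth (Assign 4 (Lit k) (Plus (var k) (Lit 1))) (Assign 4 (Lit k) bound))"
  let ?R = "\<lambda>s'. agree k s s' \<and> s' 5 0 = of_bool (\<forall>i<n. ?P i)"
  \<comment> \<open>A failing instance sets the variable to the bound, which ends the loop with truth value 0.\<close>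
  have loop: "runs (While ?b ?B) s' ((n - s' 4 k) * (?T + 15) + 6) ?R"
    if "agree k s s'" "s' 4 k \<le> n" "s' 5 0 = of_bool (\<forall>i<s' 4 k. ?P i)"
      "s' 5 0 = 0 \<Longrightarrow> s' 4 k = n" for s'
    using that
  proof (induction "n - s' 4 k" arbitrary: s' rule: less_induct)
    case less
    have n: "s' 0 0 = n" using less.prems(1) All.prems(2) unfolding agree_def by simp
    show ?case
    proof (cases "s' 4 k = n")
      case True
      have "runs (While ?b ?B) s' (1 + expr_cost ?b) ?R"
        using less.prems(1,3) True n by (intro runs_while_stop) simp_all
      then show ?thesis by (rule runs_mono) auto
    next
      case False
      define i where "i = s' 4 k"
      have "i < n" using False less.prems(2) unfolding i_def by simp
      then have "s' 5 0 \<noteq> 0" using False less.prems(4) by blast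
      then have "\<forall>j<i. ?P j" using less.prems(3) unfolding i_def of_bool_def by presburger
      note i = \<open>i < n\<close> this
      \<comment> \<open>Up to scratch space the current state is the start state with the variable
        set to \<open>i\<close>, so the body evaluates instance \<open>i\<close>.\<close>
      have ag: "agree (Suc k) (set_var k i s) s'"
        using agree_set_var_Suc less.prems(1) i_def by simp
      have val: "formula_val (Suc k) f s' = ?P i"
        using formula_val_agree[OF _ ag] All.prems(1) by simp
      let ?Q = "\<lambda>s''. agree k s s'' \<and> s'' 4 k = (if ?P i then Suc i else n) \<and> s'' 5 0 = of_bool (?P i)"
      have "runs ?B s' (?T + (1 + expr_cost truth + 6)) ?Q"
      proof (rule runs_seq[OF All.IH])
        show "wf_formula (Suc k) f" "s' 0 0 = n" using All.prems n by auto
        fix s'' assume s'': "agree (Suc k) s' s'' \<and> s'' 5 0 = of_bool (formula_val (Suc k) f s')"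
        then have "agree k s s''" using agree_trans[OF less.prems(1) agree_Suc] by blast
        moreover have "s'' 5 0 = of_bool (?P i)" using s'' val by simp
        moreover have "s'' 4 k = i" "s'' 0 0 = n"
          using s'' n i_def unfolding agree_def by simp_all
        ultimately have s: "agree k s s''" "s'' 5 0 = of_bool (?P i)" "s'' 4 k = i" "s'' 0 0 = n" .
        have upd: "?Q (s''(4 := (s'' 4)(k := if ?P i then Suc i else n)))"
          using s by (simp add: agree_def)
        show "runs (Cond truth (Assign 4 (Lit k) (Plus (var k) (Lit 1))) (Assign 4 (Lit k) bound))
            s'' (1 + expr_cost truth + 6) ?Q"
        proof (rule runs_cond)
          assume "expr_val truth s'' \<noteq> 0"
          then have "?P i" using s(2) by (simp split: if_splits)
          then show "runs (Assign 4 (Lit k) (Plus (var k) (Lit 1))) s'' 6 ?Q"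
            using upd s(3) by (intro runs_assign) simp_all
        next
          assume "expr_val truth s'' = 0"
          then have "\<not> ?P i" using s(2) by simp
          then show "runs (Assign 4 (Lit k) bound) s'' 6 ?Q"
            using upd s(4) by (intro runs_assign) simp_all
        qed
      qed
      then have "runs (While ?b ?B) s'
          (1 + expr_cost ?b + (?T + (1 + expr_cost truth + 6)) + ((n - Suc i) * (?T + 15) + 6)) ?R"
      proof (rule runs_while_step[rotated])
        show "expr_val ?b s' \<noteq> 0" using i n i_def by simp
        fix s'' assume Q: "?Q s''"
        have "runs (While ?b ?B) s'' ((n - s'' 4 k) * (?T + 15) + 6) ?R"
        proof (rule less.hyps)
          show "n - s'' 4 k < n - s' 4 k" "s'' 4 k \<le> n" using Q i i_def by auto
          show "s'' 5 0 = of_bool (\<forall>i<s'' 4 k. ?P i)" using Q i by (auto simp: less_Suc_eq)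
        qed (use Q in \<open>auto split: if_splits\<close>)
        \<comment> \<open>After a failing instance the variable is \<open>n\<close>, and what
          remains fits easily into the budget for \<open>n - Suc i\<close> passes.\<close>
        then show "runs (While ?b ?B) s'' ((n - Suc i) * (?T + 15) + 6) ?R"
          using Q i by (elim runs_mono) (auto split: if_splits)
      qed
      moreover have "n - s' 4 k = Suc (n - Suc i)" using i i_def by simp
      ultimately show ?thesis by (elim runs_mono) auto
    qed
  qed
  have "runs (test k (All f)) s (3 + (3 + (n * (?T + 15) + 6))) ?R"
    unfolding test.simps
  proof (rule runs_seq)
    let ?s = "s(5 := (s 5)(0 := 1))"
    show "runs (Assign 5 (Lit 0) (Lit 1)) s 3 (\<lambda>s'. s' = ?s)" by (rule runs_assign) simp_all
    fix s' assume s': "s' = ?s"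
    show "runs (Seq (Assign 4 (Lit k) (Lit 0)) (While ?b ?B)) s' (3 + (n * (?T + 15) + 6)) ?R"
    proof (rule runs_seq)
      show "runs (Assign 4 (Lit k) (Lit 0)) s' 3 (\<lambda>s''. s'' = set_var k 0 ?s)"
        by (rule runs_assign) (simp_all add: s' set_var_def)
      show "runs (While ?b ?B) s'' (n * (?T + 15) + 6) ?R" if "s'' = set_var k 0 ?s" for s''
        using loop[of s''] that by (simp add: agree_def)
    qed
  qed
  then show ?case by (rule runs_mono) (auto simp: All.prems(2))
qed

text \<open>The two truncated differences add up to 0 exactly if the values are equal.\<close>

definition Eq :: "expr \<Rightarrow> expr \<Rightarrow> formula" where
  "Eq e f = Atom (Monus (Lit 1) (Plus (Monus e f) (Monus f e)))"
definition Less :: "expr \<Rightarrow> expr \<Rightarrow> formula" where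
  "Less e f = Atom (Monus f e)"
definition Imp :: "formula \<Rightarrow> formula \<Rightarrow> formula" where
  "Imp f g = Neg (Conj f (Neg g))"
definition Disj :: "formula \<Rightarrow> formula \<Rightarrow> formula" where
  "Disj f g = Neg (Conj (Neg f) (Neg g))"
definition Ex :: "formula \<Rightarrow> formula" where
  "Ex f = Neg (All (Neg f))"

lemma formula_val_derived [simp]:
  "formula_val k (Eq e f) s = (expr_val e s = expr_val f s)"
  "formula_val k (Less e f) s = (expr_val e s < expr_val f s)"
  "formula_val k (Imp g h) s = (formula_val k g s \<longrightarrow> formula_val k h s)"
  "formula_val k (Disj g h) s = (formula_val k g s \<or> formula_val k h s)"
  "formula_val k (Ex g) s = (\<exists>i<s 0 0. formula_val (Suc k) g (set_var k i s))"
  unfolding Eq_def Less_def Imp_def Disj_def Ex_def by auto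

lemma wf_formula_derived [simp]:
  "wf_formula k (Eq e f) = (wf_expr k e \<and> wf_expr k f)"
  "wf_formula k (Less e f) = (wf_expr k e \<and> wf_expr k f)"
  "wf_formula k (Imp g h) = (wf_formula k g \<and> wf_formula k h)"
  "wf_formula k (Disj g h) = (wf_formula k g \<and> wf_formula k h)"
  "wf_formula k (Ex g) = wf_formula (Suc k) g"
  unfolding Eq_def Less_def Imp_def Disj_def Ex_def by auto

section \<open>Counted loops and guarded assignments\<close>

definition iterate :: "nat \<Rightarrow> prog \<Rightarrow> prog" where
  "iterate k P = Seq (Assign 4 (Lit k) (Lit 0)) (While (Monus bound (var k))
     (Seq P (Assign 4 (Lit k) (Plus (var k) (Lit 1)))))"

text \<open>\<open>I i\<close> holds before pass \<open>i\<close>. The counter lives in memory, so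
  the body has to leave it as found and the invariant has to survive any change of it.\<close>

lemma runs_iterate:
  assumes step: "\<And>i s. i < n \<Longrightarrow> I i s \<Longrightarrow> s 4 k = i \<Longrightarrow>
      runs P s (poly q n) (\<lambda>s'. s' 4 k = i \<and> I (Suc i) s')"
    and inv: "\<And>i j s. I i s \<Longrightarrow> I i (set_var k j s)"
    and bound: "\<And>i s. I i s \<Longrightarrow> s 0 0 = n"
    and init: "I 0 s"
  shows "runs (iterate k P) s (poly (loop_time q) n) (I n)"
proof -
  let ?T = "poly q n"
  let ?b = "Monus bound (var k)"
  let ?B = "Seq P (Assign 4 (Lit k) (Plus (var k) (Lit 1)))"
  have loop: "runs (While ?b ?B) s' (d * (?T + 15) + 6) (I n)"
    if "I i s'" "s' 4 k = i" "i + d = n" for s' i d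
    using that
  proof (induction d arbitrary: s' i)
    case 0
    then show ?case
      using bound[OF 0(1)] by (intro runs_mono[OF runs_while_stop[of ?b s' "I n"]]) auto
  next
    case (Suc d)
    have "runs ?B s' (?T + 6) (\<lambda>s''. s'' 4 k = Suc i \<and> I (Suc i) s'')"
    proof (rule runs_seq[OF step])
      fix s'' assume "s'' 4 k = i \<and> I (Suc i) s''"
      then show "runs (Assign 4 (Lit k) (Plus (var k) (Lit 1))) s'' 6
          (\<lambda>s''. s'' 4 k = Suc i \<and> I (Suc i) s'')"
        using inv[of "Suc i" s'' "Suc i"] by (intro runs_assign) (auto simp: set_var_def)
    qed (use Suc.prems in auto)
    then have "runs (While ?b ?B) s' (1 + expr_cost ?b + (?T + 6) + (d * (?T + 15) + 6)) (I n)"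
    proof (rule runs_while_step[rotated])
      show "expr_val ?b s' \<noteq> 0" using Suc.prems bound[OF Suc.prems(1)] by simp
    qed (use Suc in auto)
    then show ?case by (rule runs_mono) auto
  qed
  have "runs (iterate k P) s (3 + (n * (?T + 15) + 6)) (I n)"
    unfolding iterate_def
  proof (rule runs_seq)
    show "runs (Assign 4 (Lit k) (Lit 0)) s 3 (\<lambda>s'. s' = set_var k 0 s)"
      by (rule runs_assign) (simp_all add: set_var_def)
    show "runs (While ?b ?B) s' (n * (?T + 15) + 6) (I n)" if "s' = set_var k 0 s" for s'
      using loop[of 0 s' n] inv[OF init, of 0] that by simp
  qed
  then show ?thesis by (rule runs_mono) auto
qed

definition guarded :: "nat \<Rightarrow> formula \<Rightarrow> nat \<Rightarrow> expr \<Rightarrow> expr \<Rightarrow> prog" where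
  "guarded k g a e f = Seq (test k g) (Cond truth (Assign a e f) Skip)"

definition guarded_time :: "formula \<Rightarrow> expr \<Rightarrow> expr \<Rightarrow> nat poly" where
  "guarded_time g e f = test_time g + [:4 + expr_cost e + expr_cost f:]"

text \<open>The assignment comes after the test, but \<open>e\<close> and \<open>f\<close> do not
  read the scratch space of the test, so their values in the start state are the ones used.\<close>

lemma runs_guarded:
  assumes "wf_formula k g" "wf_expr k e" "wf_expr k f" "s 0 0 = n" "a \<noteq> 4" "a \<noteq> 5"
  defines "s1 \<equiv> if formula_val k g s then s(a := (s a)(expr_val e s := expr_val f s)) else s"
  shows "runs (guarded k g a e f) s (poly (guarded_time g e f) n) (agree k s1)"
proof -
  have "runs (guarded k g a e f) s
      (poly (test_time g) n + (1 + expr_cost truth + (1 + expr_cost e + expr_cost f))) (agree k s1)"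
    unfolding guarded_def
  proof (rule runs_seq[OF runs_test[of k g s n]])
    fix s' assume s': "agree k s s' \<and> s' 5 0 = of_bool (formula_val k g s)"
    have "expr_val e s' = expr_val e s" "expr_val f s' = expr_val f s"
      using s' expr_val_agree assms(2,3) by blast+
    then show "runs (Cond truth (Assign a e f) Skip) s'
        (1 + expr_cost truth + (1 + expr_cost e + expr_cost f)) (agree k s1)"
      using s' assms(5,6) unfolding s1_def
      by (intro runs_cond runs_assign runs_skip) (auto simp: agree_def split: if_splits)
  qed (use assms in auto)
  then show ?thesis unfolding guarded_time_def by (rule runs_mono) auto
qed

lemma agreeD: "agree k b s \<Longrightarrow> a \<noteq> 4 \<Longrightarrow> a \<noteq> 5 \<Longrightarrow> s a = b a"
  unfolding agree_def by simp

section \<open>The program\<close>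

text \<open>Array 6 holds the multiples of \<open>n\<close>, so that \<open>entry a x y\<close> is the entry of the matrix stored
  in array \<open>a\<close> whose row and column are the variables \<open>x\<close> and \<open>y\<close>. Array 7 holds the distance
  matrix with all entries increased by 1, 0 meaning unknown, and array 8 the labels.\<close>

definition entry :: "nat \<Rightarrow> nat \<Rightarrow> nat \<Rightarrow> expr" where
  "entry a x y = Cell a (Plus (Cell 6 (var x)) (var y))"

lemma expr_val_entry [simp]: "expr_val (entry a x y) s = s a (s 6 (s 4 x) + s 4 y)"
  unfolding entry_def by simp

lemma wf_expr_entry [simp]:
  "a \<noteq> 4 \<Longrightarrow> a \<noteq> 5 \<Longrightarrow> x < k \<Longrightarrow> y < k \<Longrightarrow> wf_expr k (entry a x y)"
  unfolding entry_def by simp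

text \<open>Array 6 after \<open>m\<close> passes of repeated addition, as the machine cannot
  multiply. Pass \<open>i\<close> writes entry \<open>i + 1\<close>; entry 0 is correct from the
  start.\<close>

definition rows :: "nat \<Rightarrow> nat \<Rightarrow> nat \<Rightarrow> nat" where
  "rows n m u = (if u \<le> m then u * n else 0)"

lemma rows_eq: "u < n \<Longrightarrow> rows n n u = u * n"
  unfolding rows_def by simp

lemma cell_less:
  assumes "u < n" "v < n" shows "u * n + v < n * (n::nat)"
proof -
  have "u * n + v < Suc u * n" using assms by simp
  also have "\<dots> \<le> n * n" using assms(1) by (intro mult_le_mono1) simp
  finally show ?thesis .
qed

lemma adj_matrix_entry:
  assumes "u < n" "v < n" shows "adj_matrix n G (rows n n u + v) = of_bool ({u, v} \<in> G)"
  using assms cell_less unfolding adj_matrix_def by (simp add: rows_eq)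

definition rows_prog :: prog where
  "rows_prog = iterate 0 (Assign 6 (Plus (var 0) (Lit 1)) (Plus (Cell 6 (var 0)) bound))"

definition rows_time :: "nat poly" where
  "rows_time = loop_time [:20:]"

lemma runs_rows:
  assumes "s 0 0 = n" "s 6 = (\<lambda>_. 0)"
  shows "runs rows_prog s (poly rows_time n) (agree 0 (s(6 := rows n n)))"
  unfolding rows_prog_def rows_time_def
proof (rule runs_iterate[where I = "\<lambda>i. agree 0 (s(6 := rows n i))"])
  show "agree 0 (s(6 := rows n 0)) s"
    using assms(2) unfolding agree_def rows_def by (auto simp: fun_eq_iff)
  show "s' 0 0 = n" if "agree 0 (s(6 := rows n i)) s'" for i s'
    using that assms(1) unfolding agree_def by simp
  show "agree 0 (s(6 := rows n i)) (set_var 0 j s')" if "agree 0 (s(6 := rows n i)) s'" for i j s'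
    using that unfolding agree_def by simp
  fix i s' assume "i < n" "agree 0 (s(6 := rows n i)) s'" "s' 4 0 = i"
  moreover have "(rows n i)(Suc i := rows n i i + n) = rows n (Suc i)"
    unfolding rows_def by (auto simp: fun_eq_iff)
  ultimately show "runs (Assign 6 (Plus (var 0) (Lit 1)) (Plus (Cell 6 (var 0)) bound)) s'
      (poly [:20:] n) (\<lambda>s'. s' 4 0 = i \<and> agree 0 (s(6 := rows n (Suc i))) s')"
    using assms(1) by (intro runs_assign) (auto simp: agree_def)
qed

text \<open>The right-hand side of \<open>dist_step_iff\<close> for \<open>k\<close>,
  \<open>u\<close>, \<open>v\<close>, \<open>w\<close> in variables 0 to 3. An unknown entry
  expresses \<open>k \<le> d u v\<close>. Because of the shift, a stored \<open>k\<close> means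
  distance \<open>k - 1\<close>; requiring \<open>0 < k\<close> keeps unknown entries from
  matching.\<close>

definition dist_formula :: formula where
  "dist_formula = Conj (Eq (entry 7 1 2) (Lit 0))
     (Disj (Conj (Eq (var 0) (Lit 0)) (Eq (var 1) (var 2)))
           (Conj (Less (Lit 0) (var 0)) (Ex (Conj (Atom (entry 1 3 2)) (Eq (entry 7 1 3) (var 0))))))"

definition dist_prog :: prog where
  "dist_prog = iterate 0 (iterate 1 (iterate 2
     (guarded 3 dist_formula 7 (Plus (Cell 6 (var 1)) (var 2)) (Plus (var 0) (Lit 1)))))"

definition dist_time :: "nat poly" where
  "dist_time = loop_time (loop_time (loop_time
     (guarded_time dist_formula (Plus (Cell 6 (var 1)) (var 2)) (Plus (var 0) (Lit 1)))))"

section \<open>Correctness of the breadth-first search\<close>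

locale numbered_graph = connected_simple_graph "{..<n}" E for n :: nat and E
begin

text \<open>Breadth-first search from all vertices at once: the distances below \<open>k\<close> are known, and so is
  the distance \<open>k\<close> in the cells before \<open>c\<close>.\<close>

definition dist_table :: "nat \<Rightarrow> nat \<Rightarrow> nat \<Rightarrow> nat" where
  "dist_table k c i = (if i < n * n \<and> d (i div n) (i mod n) < (if i < c then Suc k else k)
     then Suc (d (i div n) (i mod n)) else 0)"

lemma dist_table_entry:
  assumes "u < n" "v < n"
  shows "dist_table k c (u * n + v) =
    (if d u v < (if u * n + v < c then Suc k else k) then Suc (d u v) else 0)"
  using assms cell_less unfolding dist_table_def by simp

lemma dist_table_init: "dist_table 0 0 = (\<lambda>_. 0)"
  unfolding dist_table_def by auto

lemma dist_table_next: "dist_table k (n * n) = dist_table (Suc k) 0"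
  unfolding dist_table_def by (auto simp: fun_eq_iff)

lemma dist_table_step:
  assumes "u < n" "v < n"
  shows "dist_table k (Suc (u * n + v)) = (if d u v = k
    then (dist_table k (u * n + v))(u * n + v := Suc k) else dist_table k (u * n + v))"
proof
  fix i
  show "dist_table k (Suc (u * n + v)) i = (if d u v = k
    then (dist_table k (u * n + v))(u * n + v := Suc k) else dist_table k (u * n + v)) i"
  proof (cases "i = u * n + v")
    case True
    then show ?thesis using dist_table_entry[OF assms] by simp
  next
    case False
    then show ?thesis unfolding dist_table_def by auto
  qed
qed

text \<open>After \<open>n\<close> rounds nothing is unknown, as all distances are below
  \<open>n\<close>.\<close>

definition dists :: "nat \<Rightarrow> nat" where
  "dists = dist_table n 0"

lemma dists_entry:
  assumes "u < n" "v < n" shows "dists (rows n n u + v) = Suc (d u v)"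
  using assms dist_table_entry dist_less_card[of u v] unfolding dists_def by (simp add: rows_eq)

lemma dist_formula_val:
  assumes "s 0 0 = n" "s 1 = adj_matrix n E" "s 6 = rows n n" "s 7 = dist_table k (u * n + v)"
    "s 4 0 = k" "s 4 1 = u" "s 4 2 = v" "u < n" "v < n"
  shows "formula_val 3 dist_formula s \<longleftrightarrow> d u v = k"
proof -
  have uv: "dist_table k (u * n + v) (rows n n u + v) = 0 \<longleftrightarrow> k \<le> d u v"
    using assms(8,9) by (simp add: rows_eq dist_table_entry not_less)
  \<comment> \<open>Entries made in the current round hold \<open>k + 1\<close>, so they cannot be
    mistaken for distance \<open>k - 1\<close>.\<close>
  have uw: "dist_table k (u * n + v) (rows n n u + w) = k \<longleftrightarrow> d u w = k - 1" if "w < n" "0 < k" for w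
    using assms(8) that by (auto simp: rows_eq dist_table_entry)
  have "formula_val 3 dist_formula s \<longleftrightarrow>
      k \<le> d u v \<and> (k = 0 \<and> u = v \<or> 0 < k \<and> (\<exists>w<n. {w, v} \<in> E \<and> d u w = k - 1))"
    unfolding dist_formula_def
    using assms by (simp add: uv uw adj_matrix_entry cong: conj_cong)
  also have "\<dots> \<longleftrightarrow> d u v = k"
    using dist_step_iff[of u v k] assms(8,9) edgeD by (auto dest: edgeD)
  finally show ?thesis .
qed

lemma runs_dist:
  assumes "s 0 0 = n" "s 1 = adj_matrix n E" "s 6 = rows n n" "s 7 = (\<lambda>_. 0)"
  shows "runs dist_prog s (poly dist_time n) (agree 0 (s(7 := dists)))"
proof -
  let ?S = "\<lambda>k c. s(7 := dist_table k c)"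
  let ?g = "guarded 3 dist_formula 7 (Plus (Cell 6 (var 1)) (var 2)) (Plus (var 0) (Lit 1))"
  let ?q = "guarded_time dist_formula (Plus (Cell 6 (var 1)) (var 2)) (Plus (var 0) (Lit 1))"
  \<comment> \<open>\<open>agree 0\<close> does not protect array 4, so the invariants carry the
    counters of the enclosing loops.\<close>
  let ?I2 = "\<lambda>k u v s'. agree 0 (?S k (u * n + v)) s' \<and> s' 4 0 = k \<and> s' 4 1 = u"
  let ?I1 = "\<lambda>k u s'. agree 0 (?S k (u * n)) s' \<and> s' 4 0 = k"
  have n: "s' 0 0 = n" if "agree 0 (?S k c) s'" for k c s'
    using that assms(1) unfolding agree_def by simp
  have inv: "agree 0 (?S k c) (set_var j i s')" if "agree 0 (?S k c) s'" for k c s' i j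
    using that unfolding agree_def by simp
  have 2: "runs ?g s' (poly ?q n) (\<lambda>s''. s'' 4 2 = v \<and> ?I2 k u (Suc v) s'')"
    if "u < n" "v < n" "?I2 k u v s'" "s' 4 2 = v" for k u v s'
  proof -
    have s': "s' 1 = adj_matrix n E" "s' 6 = rows n n" "s' 7 = dist_table k (u * n + v)"
      using that(3) assms agreeD[of 0 "?S k (u * n + v)" s'] by simp_all
    have val: "formula_val 3 dist_formula s' \<longleftrightarrow> d u v = k"
      using dist_formula_val[of s' k u v] n[of k "u * n + v" s'] s' that by simp
    show ?thesis
    proof (rule runs_mono[OF runs_guarded])
      show "wf_formula 3 dist_formula" unfolding dist_formula_def by simp
      fix s'' assume "agree 3 (if formula_val 3 dist_formula s'
        then s'(7 := (s' 7)(expr_val (Plus (Cell 6 (var 1)) (var 2)) s' := expr_val (Plus (var 0) (Lit 1)) s'))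
        else s') s''"
      then show "s'' 4 2 = v \<and> ?I2 k u (Suc v) s''"
        using that s' dist_table_step[OF that(1,2), of k] unfolding val
        by (auto simp: agree_def rows_eq split: if_splits)
    qed (use n that in auto)
  qed
  have 1: "runs (iterate 2 ?g) s' (poly (loop_time ?q) n) (\<lambda>s''. s'' 4 1 = u \<and> ?I1 k (Suc u) s'')"
    if "u < n" "?I1 k u s'" "s' 4 1 = u" for k u s'
  proof (rule runs_mono[OF runs_iterate[where I = "?I2 k u"]])
    show "runs ?g s' (poly ?q n) (\<lambda>s''. s'' 4 2 = v \<and> ?I2 k u (Suc v) s'')"
      if "v < n" "?I2 k u v s'" "s' 4 2 = v" for v s' using 2 that \<open>u < n\<close> by blast
    show "s'' 4 1 = u \<and> ?I1 k (Suc u) s''" if "?I2 k u n s''" for s''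
      using that by (simp add: add.commute)
  qed (use that inv n in \<open>auto simp del: One_nat_def\<close>)
  have 0: "runs (iterate 1 (iterate 2 ?g)) s' (poly (loop_time (loop_time ?q)) n)
      (\<lambda>s''. s'' 4 0 = k \<and> agree 0 (?S (Suc k) 0) s'')"
    if "agree 0 (?S k 0) s'" "s' 4 0 = k" for k s'
  proof (rule runs_mono[OF runs_iterate[where I = "?I1 k"]])
    show "runs (iterate 2 ?g) s' (poly (loop_time ?q) n) (\<lambda>s''. s'' 4 1 = u \<and> ?I1 k (Suc u) s'')"
      if "u < n" "?I1 k u s'" "s' 4 1 = u" for u s' using 1 that by blast
    show "s'' 4 0 = k \<and> agree 0 (?S (Suc k) 0) s''" if "?I1 k n s''" for s''
      using that dist_table_next by simp
  qed (use that inv n in auto)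
  show ?thesis
    unfolding dist_prog_def dist_time_def dists_def
  proof (rule runs_iterate[where I = "\<lambda>k. agree 0 (?S k 0)"])
    show "agree 0 (?S 0 0) s" using assms(4) dist_table_init unfolding agree_def by simp
  qed (use 0 inv n in auto)
qed

end

text \<open>Variables 0 and 1 are the vertex and the candidate root. Stored distances are one too
  large: the left side of the interval equation is off by 2 and the right by 1, which the added 1
  balances. Comparisons are unaffected.\<close>

definition label_formula :: formula where
  "label_formula = Conj (Ex (Atom (entry 2 1 2)))
     (All (Imp (Eq (Plus (entry 7 0 2) (entry 7 2 1)) (Plus (entry 7 0 1) (Lit 1)))
       (All (All (Imp (Conj (Atom (entry 2 3 4)) (Eq (Cell 3 (var 3)) (Cell 3 (var 1))))
         (Less (entry 7 2 3) (entry 7 2 4)))))))"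

definition label_prog :: prog where
  "label_prog = iterate 0 (Seq (Assign 8 (var 0) (Lit 1))
     (iterate 1 (guarded 2 label_formula 8 (var 0) (Cell 3 (var 1)))))"

definition label_time :: "nat poly" where
  "label_time = loop_time ([:5:] + loop_time (guarded_time label_formula (var 0) (Cell 3 (var 1))))"

text \<open>Follows \<open>valid_labelling\<close> conjunct by conjunct, with array 8 for
  \<open>L\<close> and the same correction in the interval equation.\<close>

definition valid_formula :: formula where
  "valid_formula =
     Conj (Neg (Less bound (Cell 0 (Lit 1))))
    (Conj (All (Imp (Less (var 0) (Cell 0 (Lit 1))) (Ex (Eq (Cell 8 (var 1)) (Plus (var 0) (Lit 1))))))
    (Conj (All (All (Imp (Eq (Cell 8 (var 0)) (Cell 8 (var 1))) (All
            (Imp (Eq (Plus (entry 7 0 2) (entry 7 2 1)) (Plus (entry 7 0 1) (Lit 1)))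
              (Eq (Cell 8 (var 2)) (Cell 8 (var 0))))))))
    (Conj (All (All (Imp (Atom (entry 2 0 1))
            (Conj (Neg (Eq (Cell 8 (var 0)) (Cell 8 (var 1)))) (Eq (Cell 8 (var 0)) (Cell 3 (var 0)))))))
    (Conj (All (All (Imp (Conj (Atom (entry 1 0 1)) (Neg (Eq (Cell 8 (var 0)) (Cell 8 (var 1)))))
            (Ex (Ex (Conj (Atom (entry 2 2 3))
              (Conj (Eq (Cell 8 (var 2)) (Cell 8 (var 0))) (Eq (Cell 8 (var 3)) (Cell 8 (var 1))))))))))
          (All (All (Imp (Atom (entry 2 0 1)) (All (All (Imp (Conj (Atom (entry 2 2 3))
              (Conj (Eq (Cell 8 (var 2)) (Cell 8 (var 0))) (Eq (Cell 8 (var 3)) (Cell 8 (var 1)))))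
            (Conj (Eq (var 2) (var 0)) (Eq (var 3) (var 1)))))))))))))"

text \<open>The output array 1 also holds the adjacency matrix of \<open>E\<close>, so it is
  overwritten only after all checks.\<close>

definition copy_prog :: prog where
  "copy_prog = iterate 0 (Assign 1 (var 0) (Cell 8 (var 0)))"

definition copy_time :: "nat poly" where
  "copy_time = loop_time [:20:]"

lemma runs_copy:
  assumes "s 0 0 = n"
  shows "runs copy_prog s (poly copy_time n)
    (\<lambda>s'. s' 0 = s 0 \<and> s' 9 = s 9 \<and> (\<forall>v<n. s' 1 v = s 8 v))"
proof -
  let ?I = "\<lambda>i (s' :: memory). s' 0 = s 0 \<and> s' 8 = s 8 \<and> s' 9 = s 9 \<and> (\<forall>v<i. s' 1 v = s 8 v)"
  have "runs copy_prog s (poly copy_time n) (?I n)"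
    unfolding copy_prog_def copy_time_def
  proof (rule runs_iterate[where I = ?I])
    fix i s' assume "?I i s'" "s' 4 0 = i"
    then show "runs (Assign 1 (var 0) (Cell 8 (var 0))) s' (poly [:20:] n)
        (\<lambda>s'. s' 4 0 = i \<and> ?I (Suc i) s')"
      by (intro runs_assign) (auto simp: less_Suc_eq)
  qed (use assms in auto)
  then show ?thesis by (rule runs_mono) auto
qed

text \<open>The verdict waits in array 9, because cell 0 of array 0 serves as the bound of every
  loop until the end.\<close>

definition skeleton_prog :: prog where
  "skeleton_prog = Seq rows_prog (Seq dist_prog (Seq label_prog
     (Seq (guarded 0 valid_formula 9 (Lit 0) (Lit 1))
       (Seq copy_prog (Assign 0 (Lit 0) (Cell 9 (Lit 0)))))))"

definition skeleton_time :: "nat poly" where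
  "skeleton_time = rows_time + (dist_time + (label_time +
     (guarded_time valid_formula (Lit 0) (Lit 1) + (copy_time + [:20:]))))"

section \<open>Correctness of labelling, checking and the whole program\<close>

locale skeleton_input = numbered_graph n E for n :: nat and E +
  fixes p :: nat and F :: "nat set set" and \<phi> :: "nat \<Rightarrow> nat"
  assumes FE: "F \<subseteq> E"
begin

definition prepared :: memory where
  "prepared = (input n E p F \<phi>)(6 := rows n n, 7 := dists)"

lemma prepared_simps:
  "prepared 0 0 = n" "prepared 0 (Suc 0) = p" "prepared (Suc 0) = adj_matrix n E" "prepared 2 = adj_matrix n F"
  "x \<in> \<Union>F \<Longrightarrow> prepared 3 x = \<phi> x" "prepared 6 = rows n n" "prepared 7 = dists"
  unfolding prepared_def input_def by simp_all

lemma label_formula_val: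
  assumes s: "\<And>a. a \<in> {0,1,2,3,6,7} \<Longrightarrow> s a = prepared a"
    and v: "s 4 0 = v" "s 4 1 = a" "v < n" "a < n"
  shows "formula_val 2 label_formula s \<longleftrightarrow> a \<in> \<Union>F \<and> attracted F \<phi> a v"
proof -
  have s': "s 0 = prepared 0" "s 2 = prepared 2" "s 3 = prepared 3" "s 6 = rows n n" "s 7 = dists"
    using s prepared_simps by simp_all
  have F: "(\<exists>y<n. {a, y} \<in> F) \<longleftrightarrow> a \<in> \<Union>F"
  proof
    assume "a \<in> \<Union>F"
    then obtain e where "e \<in> F" "a \<in> e" by blast
    moreover then obtain x y where "e = {x, y}" "x < n" "y < n" using FE edgeE[of e] by auto
    ultimately show "\<exists>y<n. {a, y} \<in> F" by (auto simp: insert_commute)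
  qed blast
  have "formula_val 2 label_formula s \<longleftrightarrow> (\<exists>y<n. {a, y} \<in> F) \<and>
      (\<forall>w<n. d v w + d w a = d v a \<longrightarrow>
        (\<forall>x<n. \<forall>y<n. {x, y} \<in> F \<and> prepared 3 x = prepared 3 a \<longrightarrow> d w x < d w y))"
    unfolding label_formula_def
    using v by (simp add: s' prepared_simps adj_matrix_entry dists_entry cong: conj_cong)
  \<comment> \<open>Array 3 is known to equal \<open>\<phi>\<close> only on
    \<open>\<Union>F\<close>; this contains \<open>x\<close> as an end of \<open>{x, y}\<close> and
    \<open>a\<close> by the first conjunct.\<close>
  also have "\<dots> \<longleftrightarrow> a \<in> \<Union>F \<and> (\<forall>w<n. d v w + d w a = d v a \<longrightarrow>
        (\<forall>x<n. \<forall>y<n. {x, y} \<in> F \<and> \<phi> x = \<phi> a \<longrightarrow> d w x < d w y))"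
    unfolding F using prepared_simps(5) by (metis UnionI insertI1)
  finally show ?thesis unfolding attracted_def nearer_def by (simp add: Ball_def)
qed

definition labels :: "nat \<Rightarrow> nat \<Rightarrow> nat" where
  "labels v u = (if u < v then root_label F \<phi> [0..<n] u else 0)"

lemma runs_label:
  assumes "agree 0 prepared s"
  shows "runs label_prog s (poly label_time n) (agree 0 (prepared(8 := labels n)))"
proof -
  let ?S = "\<lambda>v. prepared(8 := labels v)"
  \<comment> \<open>Within the inner loop, cell \<open>v\<close> holds the label obtained from the
    candidates below \<open>a\<close>; for \<open>a = 0\<close> this is the default 1 just
    written.\<close>
  let ?S1 = "\<lambda>v a. prepared(8 := (labels v)(v := root_label F \<phi> [0..<a] v))"
  let ?g = "guarded 2 label_formula 8 (var 0) (Cell 3 (var 1))"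
  let ?q = "guarded_time label_formula (var 0) (Cell 3 (var 1))"
  let ?I1 = "\<lambda>v a s'. agree 0 (?S1 v a) s' \<and> s' 4 0 = v"
  have n: "?S v 0 0 = n" "?S1 v a 0 0 = n" for v a
    using prepared_simps(1) by simp_all
  have 1: "runs ?g s' (poly ?q n) (\<lambda>s''. s'' 4 1 = a \<and> ?I1 v (Suc a) s'')"
    if "v < n" "a < n" "?I1 v a s'" "s' 4 1 = a" for v a s'
  proof -
    have s': "s' b = prepared b" if "b \<noteq> 4" "b \<noteq> 5" "b \<noteq> 8" for b
      using agreeD[of 0 "?S1 v a" s' b] \<open>?I1 v a s'\<close> that by simp
    have val: "formula_val 2 label_formula s' \<longleftrightarrow> a \<in> \<Union>F \<and> attracted F \<phi> a v"
    proof (rule label_formula_val)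
      show "s' b = prepared b" if "b \<in> {0,1,2,3,6,7}" for b using s'[of b] that by auto
    qed (use that in auto)
    have step: "root_label F \<phi> [0..<Suc a] v =
        (if a \<in> \<Union>F \<and> attracted F \<phi> a v then \<phi> a else root_label F \<phi> [0..<a] v)"
      unfolding root_label_def by simp
    show ?thesis
    proof (rule runs_mono[OF runs_guarded])
      show "wf_formula 2 label_formula" unfolding label_formula_def by simp
      show "s' 0 0 = n" using s'[of 0] prepared_simps(1) by simp
      fix s'' assume "agree 2 (if formula_val 2 label_formula s'
        then s'(8 := (s' 8)(expr_val (var 0) s' := expr_val (Cell 3 (var 1)) s')) else s') s''"
      then show "s'' 4 1 = a \<and> ?I1 v (Suc a) s''"
        using that s'[of 3] prepared_simps(5)[of a] unfolding val step
        by (auto simp: agree_def split: if_splits)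
    qed (use that in auto)
  qed
  have 0: "runs (Seq (Assign 8 (var 0) (Lit 1)) (iterate 1 ?g)) s' (poly ([:5:] + loop_time ?q) n)
      (\<lambda>s''. s'' 4 0 = v \<and> agree 0 (?S (Suc v)) s'')"
    if "v < n" "agree 0 (?S v) s'" "s' 4 0 = v" for v s'
  proof -
    have "runs (Seq (Assign 8 (var 0) (Lit 1)) (iterate 1 ?g)) s' (5 + poly (loop_time ?q) n)
      (\<lambda>s''. s'' 4 0 = v \<and> agree 0 (?S (Suc v)) s'')"
    proof (rule runs_seq)
      show "runs (Assign 8 (var 0) (Lit 1)) s' 5 (?I1 v 0)"
        using that by (intro runs_assign) (auto simp: agree_def root_label_def)
      fix s1 assume s1: "?I1 v 0 s1"
      show "runs (iterate 1 ?g) s1 (poly (loop_time ?q) n)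
          (\<lambda>s''. s'' 4 0 = v \<and> agree 0 (?S (Suc v)) s'')"
      proof (rule runs_mono[OF runs_iterate[where I = "?I1 v"]])
        show "runs ?g s' (poly ?q n) (\<lambda>s''. s'' 4 1 = a \<and> ?I1 v (Suc a) s'')"
          if "a < n" "?I1 v a s'" "s' 4 1 = a" for a s' using 1 that \<open>v < n\<close> by blast
        have "(labels v)(v := root_label F \<phi> [0..<n] v) = labels (Suc v)"
          unfolding labels_def by (auto simp: fun_eq_iff)
        then show "s'' 4 0 = v \<and> agree 0 (?S (Suc v)) s''" if "?I1 v n s''" for s''
          using that by simp
        show "?I1 v a (set_var 1 j s')" if "?I1 v a s'" for a j s'
          using that by (simp add: agree_def)
        show "s' 0 0 = n" if "?I1 v a s'" for a s'
          using that prepared_simps(1) by (simp add: agree_def)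
      qed (use s1 in auto)
    qed
    then show ?thesis by simp
  qed
  show ?thesis
    unfolding label_prog_def label_time_def
  proof (rule runs_iterate[where I = "\<lambda>v. agree 0 (?S v)"])
    show "agree 0 (?S 0) s"
      using assms unfolding agree_def labels_def
      by (auto simp: prepared_def input_def fun_eq_iff)
    show "agree 0 (?S v) (set_var 0 j s')" if "agree 0 (?S v) s'" for v j s'
      using that by (simp add: agree_def)
    show "s' 0 0 = n" if "agree 0 (?S v) s'" for v s'
      using that prepared_simps(1) by (simp add: agree_def)
  qed (use 0 in auto)
qed

lemma valid_formula_val:
  assumes s: "\<And>a. a \<in> {0,1,2,3,6,7} \<Longrightarrow> s a = prepared a"
  shows "formula_val 0 valid_formula s \<longleftrightarrow> valid_labelling n E p F \<phi> (s 8)"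
proof -
  have s': "s 0 = prepared 0" "s 2 = prepared 2" "s 3 = prepared 3" "s 6 = rows n n" "s 7 = dists"
    "s (Suc 0) = prepared (Suc 0)"
    using s prepared_simps by simp_all
  have phi: "prepared 3 u = \<phi> u" if "{u, v} \<in> F" for u v
    using prepared_simps(5)[of u] that by blast
  show ?thesis
    \<comment> \<open>The conjuncts are matched one at a time. \<open>conj_cong\<close> makes
      membership in \<open>F\<close> available where array 3 is replaced by
      \<open>\<phi>\<close>.\<close>
    unfolding valid_formula_def valid_labelling_def formula_val.simps(3)
    by (intro arg_cong2[of _ _ _ _ "(\<and>)"])
      (simp_all add: s' prepared_simps phi adj_matrix_entry dists_entry not_less cong: conj_cong)
qed

theorem skeleton_prog_correct:
  "runs skeleton_prog (input n E p F \<phi>) (poly skeleton_time n)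
     (\<lambda>s. (accepted s \<longleftrightarrow> valid_labelling n E p F \<phi> (labels n)) \<and> (\<forall>v<n. s 1 v = labels n v))"
proof -
  let ?s = "input n E p F \<phi>"
  have in0: "?s 0 0 = n" "?s 1 = adj_matrix n E" "?s 6 = (\<lambda>_. 0)" "?s 7 = (\<lambda>_. 0)" "?s 9 = (\<lambda>_. 0)"
    unfolding input_def by simp_all
  show ?thesis
    unfolding skeleton_prog_def skeleton_time_def poly_add
  proof (rule runs_seq[OF runs_rows], goal_cases)
    case (3 s1)
    have s1: "s1 0 0 = n" "s1 1 = adj_matrix n E" "s1 6 = rows n n" "s1 7 = (\<lambda>_. 0)"
      using agreeD[OF 3] in0 by simp_all
    show ?case
    proof (rule runs_seq[OF runs_dist[OF s1]], goal_cases)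
      case (1 s2)
      have "agree 0 prepared s2"
        using 1 3 unfolding prepared_def agree_def by simp
      then show ?case
      proof (rule runs_seq[OF runs_label], goal_cases)
        case (1 s3)
        have s3: "s3 0 0 = n" "s3 8 = labels n" "s3 9 = (\<lambda>_. 0)"
          "\<And>a. a \<in> {0,1,2,3,6,7} \<Longrightarrow> s3 a = prepared a"
          using agreeD[OF 1] prepared_simps(1) unfolding prepared_def input_def by auto
        have wf: "wf_formula 0 valid_formula" unfolding valid_formula_def by simp
        show ?case
        proof (rule runs_seq[OF runs_guarded[of 0 valid_formula "Lit 0" "Lit 1" s3 n 9]], goal_cases)
          case (7 s4)
          \<comment> \<open>Array 9 was 0 so far, so the guarded write leaves exactly the truth
            value.\<close>
          have s4: "s4 0 0 = n" "s4 8 = labels n"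
            "s4 9 0 = of_bool (valid_labelling n E p F \<phi> (labels n))"
            using agreeD[OF 7] s3(1-3) valid_formula_val[OF s3(4)] by auto
          show ?case
          proof (rule runs_seq[OF runs_copy[of s4 n, OF s4(1)]], goal_cases)
            case (1 s5)
            then show ?case
              using s4(2,3) by (intro runs_assign) (simp_all add: accepted_def)
          qed
        qed (use wf s3 in auto)
      qed
    qed
  qed (use in0 in auto)
qed

end

theorem theorem1:
  "(\<forall>(V :: 'a set) E p F \<phi> X Y.
      simple_graph V E \<and> connected_graph V E \<and> bipartite V E \<and> p \<ge> 1 \<and>
      F \<subseteq> E \<and> \<phi> \<in> \<Union>F \<rightarrow> {1..p} \<and>
      convex_partition V E p X \<and> skeleton E p X F \<phi> \<and>
      convex_partition V E p Y \<and> skeleton E p Y F \<phi> \<longrightarrow>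
      (\<forall>i\<in>{1..p}. X i = Y i))
   \<and>
   (\<exists>P (q :: nat poly). \<forall>n E p F \<phi>.
      simple_graph {..<n} E \<and> connected_graph {..<n} E \<and> bipartite {..<n} E \<and> p \<ge> 1 \<and>
      F \<subseteq> E \<and> \<phi> \<in> \<Union>F \<rightarrow> {1..p} \<longrightarrow>
      (\<exists>t s. exec P (input n E p F \<phi>) t s \<and> t \<le> poly q n \<and>
         (if accepted s
          then convex_partition {..<n} E p (output_part n s) \<and>
               skeleton E p (output_part n s) F \<phi>
          else \<not> (\<exists>X. convex_partition {..<n} E p X \<and> skeleton E p X F \<phi>))))"
proof (intro conjI allI impI ballI exI[of _ skeleton_prog] exI[of _ skeleton_time])
  fix V :: "'a set" and E p F \<phi> X Y i
  assume *: "simple_graph V E \<and> connected_graph V E \<and> bipartite V E \<and> p \<ge> 1 \<and>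
      F \<subseteq> E \<and> \<phi> \<in> \<Union>F \<rightarrow> {1..p} \<and>
      convex_partition V E p X \<and> skeleton E p X F \<phi> \<and>
      convex_partition V E p Y \<and> skeleton E p Y F \<phi>" and i: "i \<in> {1..p}"
  then have "skeleton_partition V E p X F \<phi>" "skeleton_partition V E p Y F \<phi>"
    by unfold_locales auto
  then show "X i = Y i" using skeleton_partition_unique i by blast
next
  fix n p :: nat and E F \<phi>
  assume *: "simple_graph {..<n} E \<and> connected_graph {..<n} E \<and> bipartite {..<n} E \<and> p \<ge> 1 \<and>
      F \<subseteq> E \<and> \<phi> \<in> \<Union>F \<rightarrow> {1..p}"
  then interpret skeleton_input n E p F \<phi> by unfold_locales auto
  obtain t s where run: "exec skeleton_prog (input n E p F \<phi>) t s" "t \<le> poly skeleton_time n"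
    and acc: "accepted s \<longleftrightarrow> valid_labelling n E p F \<phi> (labels n)"
    and L: "\<And>v. v < n \<Longrightarrow> s 1 v = labels n v"
    using skeleton_prog_correct unfolding runs_def by blast
  have out: "output_part n s = (\<lambda>i. {v \<in> {..<n}. labels n v = i})"
    unfolding output_part_def using L by auto
  \<comment> \<open>Below \<open>n\<close> the table \<open>labels n\<close> is
    \<open>root_label\<close> for the full list \<open>[0..<n]\<close>, so verdict and output are
    those of the candidate labelling.\<close>
  have "if accepted s
      then convex_partition {..<n} E p (output_part n s) \<and> skeleton E p (output_part n s) F \<phi>
      else \<not> (\<exists>X. convex_partition {..<n} E p X \<and> skeleton E p X F \<phi>)"
    unfolding acc out using * by (intro valid_root_labelling_iff) (simp_all add: labels_def)
  then show "\<exists>t s. exec skeleton_prog (input n E p F \<phi>) t s \<and> t \<le> poly skeleton_time n \<and>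
      (if accepted s
       then convex_partition {..<n} E p (output_part n s) \<and> skeleton E p (output_part n s) F \<phi>
       else \<not> (\<exists>X. convex_partition {..<n} E p X \<and> skeleton E p X F \<phi>))"
    using run by blast
qed

end
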